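(* Let $0<\alpha<\beta<\infty$ and $w\in\mathcal W_{\alpha,\beta}$. For every integer $k\ge1$, the $k$-th factorial moment measure of $X_w$ is absolutely continuous with respect to Lebesgue measure on $\mathbb R^k$. A bounded continuous, symmetric, and diagonally translation-invariant representative of its density is given by \[ \rho_w^{(k)}(x_1,\ldots,x_k)=\int_0^\infty\cdots\int_0^\infty\left(\prod_{j=1}^k w(y_j)\right)\det\left[K_{\mathbb H}(x_i+iy_i,x_j+iy_j)\right]_{i,j=1}^k\,\mathrm dy_1\cdots\mathrm dy_k . \] Moreover, $0\le\rho_w^{(k)}(x_1,\ldots,x_k)\le\lambda_w^k$ for all $(x_1,\ldots,x_k)\in\mathbb R^k$.
   Context: $\mathbb H=\{x+iy:x\in\mathbb R,\ y>0\}$ with planar Lebesgue measure $\mathrm dA$. $Z_{\mathbb H}$ is the determinantal point process on $\mathbb H$ with kernel $K_{\mathbb H}(z,\zeta)=-\frac{1}{\pi(z-\overline\zeta)^2}$ relative to $\mathrm dA$, i.e. for every $k\ge1$ its $k$-th factorial moment measure has density $\det[K_{\mathbb H}(z_i,z_j)]_{i,j=1}^k$ with respect to $\mathrm dA^{\otimes k}$. $\mathcal W_{\alpha,\beta}$ is the set of Borel functions $w:(0,\infty)\to[0,1]$ with $w(y)=0$ for $y\notin[\alpha,\beta]$ and $\int_\alpha^\beta w(y)\,\mathrm dy>0$. $M_w$ is obtained from $Z_{\mathbb H}$ by independently retaining each point $z=x+iy$ with probability $w(y)$, and $X_w=\sum_{z\in M_w}\delta_{\operatorname{Re}z}$, a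 point process on $\mathbb R$. $\lambda_w=\frac1{4\pi}\int_0^\infty w(y)y^{-2}\,\mathrm dy$. The $k$-th factorial moment measure of $X_w$ is the measure $F\mapsto\mathbb E\sum^{\neq}_{x_1,\ldots,x_k\in X_w}F(x_1,\ldots,x_k)$ on $\mathbb R^k$, the sum being over ordered $k$-tuples of pairwise distinct points. Diagonal translation invariance means $\rho_w^{(k)}(x_1+t,\ldots,x_k+t)=\rho_w^{(k)}(x_1,\ldots,x_k)$ for all $t\in\mathbb R$. *)

theory Defs
  imports "HOL-Probability.Probability" "Jordan_Normal_Form.Determinant"
begin

section \<open>Point processes and factorial moment measures\<close>

text \<open>
  A point configuration is represented by its counting measure. The measure
  \<open>distr (count_space I) borel \<zeta>\<close> used below is the sum of the Dirac measures at
  \<open>\<zeta> n\<close> for \<open>n \<in> I\<close>, counted with multiplicity.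
\<close>

definition point_process ::
    "'w measure \<Rightarrow> 'a::topological_space set \<Rightarrow> ('w \<Rightarrow> 'a measure) \<Rightarrow> bool" where
  "point_process P S Z \<longleftrightarrow>
     prob_space P \<and>
     (\<forall>\<omega>\<in>space P.
        sets (Z \<omega>) = sets borel \<and>
        emeasure (Z \<omega>) (- S) = 0 \<and>
        (\<forall>B\<in>sets borel. emeasure (Z \<omega>) B = \<infinity> \<or> (\<exists>n::nat. emeasure (Z \<omega>) B = of_nat n)) \<and>
        (\<forall>C. compact C \<and> C \<subseteq> S \<longrightarrow> emeasure (Z \<omega>) C < \<infinity>)) \<and>
     (\<forall>B\<in>sets borel. (\<lambda>\<omega>. emeasure (Z \<omega>) B) \<in> borel_measurable P)"

text \<open>A point \<open>x\<close> of multiplicity \<open>m\<close> is listed as \<open>(x, 0), \<dots>, (x, m - 1)\<close>.\<close>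

definition labelled_points :: "'a measure \<Rightarrow> ('a \<times> nat) set" where
  "labelled_points \<nu> = {(x, i). of_nat i < emeasure \<nu> {x}}"

text \<open>
  The sum of \<open>F\<close> over ordered \<open>k\<close>-tuples of pairwise distinct points of the configuration.
  Points of the \<open>k\<close>-fold power of \<open>'a\<close> are extensional functions on \<open>{..<k}\<close>, as in the product measure
  \<open>\<Pi>\<^sub>M j\<in>{..<k}. M j\<close>.
\<close>

definition factorial_sum :: "nat \<Rightarrow> 'a measure \<Rightarrow> ((nat \<Rightarrow> 'a) \<Rightarrow> ennreal) \<Rightarrow> ennreal" where
  "factorial_sum k \<nu> F =
     (\<integral>\<^sup>+ p. F (\<lambda>j\<in>{..<k}. fst (p j))
        \<partial>count_space {p \<in> {..<k} \<rightarrow>\<^sub>E labelled_points \<nu>. inj_on p {..<k}})"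

definition factorial_moment_measure ::
    "'w measure \<Rightarrow> ('w \<Rightarrow> 'a::topological_space measure) \<Rightarrow> nat \<Rightarrow> (nat \<Rightarrow> 'a) measure" where
  "factorial_moment_measure P X k =
     measure_of ({..<k} \<rightarrow>\<^sub>E UNIV) (sets (\<Pi>\<^sub>M j\<in>{..<k}. borel))
       (\<lambda>A. \<integral>\<^sup>+ \<omega>. factorial_sum k (X \<omega>) (indicator A) \<partial>P)"

section \<open>Determinantal processes and independent thinning\<close>

definition kernel_matrix :: "('a \<Rightarrow> 'a \<Rightarrow> complex) \<Rightarrow> nat \<Rightarrow> (nat \<Rightarrow> 'a) \<Rightarrow> complex mat" where
  "kernel_matrix K k z = mat k k (\<lambda>(i, j). K (z i) (z j))"

definition kernel_det :: "('a \<Rightarrow> 'a \<Rightarrow> complex) \<Rightarrow> nat \<Rightarrow> (nat \<Rightarrow> 'a) \<Rightarrow> real" where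
  "kernel_det K k z = Re (det (kernel_matrix K k z))"

text \<open>For a Hermitian kernel the determinant is real, so taking the real part loses nothing.\<close>

lemma of_real_kernel_det:
  assumes "\<And>z \<zeta>. cnj (K z \<zeta>) = K \<zeta> z"
  shows "complex_of_real (kernel_det K k z) = det (kernel_matrix K k z)"
proof -
  interpret cnj: comm_ring_hom cnj
    by unfold_locales auto
  have "map_mat cnj (kernel_matrix K k z) = transpose_mat (kernel_matrix K k z)"
    by (rule eq_matI) (auto simp: kernel_matrix_def assms)
  then have "cnj (det (kernel_matrix K k z)) = det (transpose_mat (kernel_matrix K k z))"
    by (metis cnj.hom_det)
  also have "\<dots> = det (kernel_matrix K k z)"
    by (rule det_transpose[of _ k]) (simp add: kernel_matrix_def)
  finally show ?thesis
    by (simp add: kernel_det_def complex_eq_iff)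
qed

text \<open>\<open>S\<close> is the state space, inside the type \<open>'a\<close>; the reference measure \<open>\<mu>\<close> lives on \<open>S\<close>.\<close>

definition determinantal_process ::
    "'w measure \<Rightarrow> 'a::topological_space set \<Rightarrow> 'a measure \<Rightarrow> ('a \<Rightarrow> 'a \<Rightarrow> complex)
      \<Rightarrow> ('w \<Rightarrow> 'a measure) \<Rightarrow> bool" where
  "determinantal_process P S \<mu> K Z \<longleftrightarrow>
     point_process P S Z \<and>
     (\<forall>k\<ge>1. factorial_moment_measure P Z k =
             density (\<Pi>\<^sub>M j\<in>{..<k}. \<mu>) (\<lambda>z. ennreal (kernel_det K k z)))"

text \<open>
  \<open>M\<close> arises from \<open>Z\<close> by retaining each point \<open>z\<close> independently with probability \<open>q z\<close>:
  the points of \<open>Z\<close> are enumerated measurably as \<open>\<zeta> n\<close>, for \<open>n\<close> in a random index set \<open>I\<close>, and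
  \<open>\<zeta> n\<close> is kept iff \<open>U n < q (\<zeta> n)\<close>, where the \<open>U n\<close> are i.i.d. uniform on \<open>[0, 1]\<close> and
  independent of the enumerated process.
\<close>

definition independent_thinning ::
    "'w measure \<Rightarrow> ('a::topological_space \<Rightarrow> real) \<Rightarrow> ('w \<Rightarrow> 'a measure) \<Rightarrow> ('w \<Rightarrow> 'a measure)
      \<Rightarrow> bool" where
  "independent_thinning P q Z M \<longleftrightarrow>
     (\<exists>(I :: 'w \<Rightarrow> nat set) (\<zeta> :: nat \<Rightarrow> 'w \<Rightarrow> 'a) (U :: nat \<Rightarrow> 'w \<Rightarrow> real).
        prob_space.indep_vars P (\<lambda>_. borel) U UNIV \<and>
        (\<forall>n. distr P borel (U n) = uniform_measure lborel {0..1}) \<and>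
        (\<lambda>\<omega> n. (n \<in> I \<omega>, \<zeta> n \<omega>)) \<in> measurable P (\<Pi>\<^sub>M n\<in>UNIV. count_space UNIV \<Otimes>\<^sub>M borel) \<and>
        prob_space.indep_set P
          (sets (vimage_algebra (space P) (\<lambda>\<omega> n. U n \<omega>) (\<Pi>\<^sub>M n\<in>UNIV. borel)))
          (sets (vimage_algebra (space P) (\<lambda>\<omega> n. (n \<in> I \<omega>, \<zeta> n \<omega>))
             (\<Pi>\<^sub>M n\<in>UNIV. count_space UNIV \<Otimes>\<^sub>M borel))) \<and>
        (\<forall>\<omega>\<in>space P.
           Z \<omega> = distr (count_space (I \<omega>)) borel (\<lambda>n. \<zeta> n \<omega>) \<and>
           M \<omega> = distr (count_space {n \<in> I \<omega>. U n \<omega> < q (\<zeta> n \<omega>)}) borel (\<lambda>n. \<zeta> n \<omega>)))"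

section \<open>The half-plane process and its projected strips\<close>

definition upper_half_plane :: "complex set" where
  "upper_half_plane = {z. 0 < Im z}"

text \<open>Planar Lebesgue measure on the half-plane, extended by zero to \<open>complex\<close>.\<close>

definition area_measure :: "complex measure" where
  "area_measure = density lborel (indicator upper_half_plane)"

definition kernel_H :: "complex \<Rightarrow> complex \<Rightarrow> complex" where
  "kernel_H z \<zeta> = - 1 / (of_real pi * (z - cnj \<zeta>)\<^sup>2)"

lemma of_real_kernel_det_H:
  "complex_of_real (kernel_det kernel_H k z) = det (kernel_matrix kernel_H k z)"
  by (rule of_real_kernel_det) (simp add: kernel_H_def power2_commute)

text \<open>Weights are extended by zero from \<open>(0, \<infinity>)\<close> to the real line.\<close>

definition weights :: "real \<Rightarrow> real \<Rightarrow> (real \<Rightarrow> real) set" where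
  "weights \<alpha> \<beta> =
     {w. w \<in> borel_measurable borel \<and> range w \<subseteq> {0..1} \<and>
         (\<forall>y. y \<notin> {\<alpha>..\<beta>} \<longrightarrow> w y = 0) \<and> 0 < (LINT y:{\<alpha>..\<beta>}|lborel. w y)}"

definition intensity :: "(real \<Rightarrow> real) \<Rightarrow> real" where
  "intensity w = 1 / (4 * pi) * (LINT y:{0<..}|lborel. w y / y\<^sup>2)"

definition real_projection :: "('w \<Rightarrow> complex measure) \<Rightarrow> 'w \<Rightarrow> real measure" where
  "real_projection M \<omega> = distr (M \<omega>) borel Re"

definition rho_integrand :: "(real \<Rightarrow> real) \<Rightarrow> nat \<Rightarrow> (nat \<Rightarrow> real) \<Rightarrow> (nat \<Rightarrow> real) \<Rightarrow> real" where
  "rho_integrand w k x y =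
     (\<Prod>j<k. w (y j)) * kernel_det kernel_H k (\<lambda>j. Complex (x j) (y j))"

definition rho :: "(real \<Rightarrow> real) \<Rightarrow> nat \<Rightarrow> (nat \<Rightarrow> real) \<Rightarrow> real" where
  "rho w k x =
     (LINT y:({..<k} \<rightarrow>\<^sub>E {0<..})|(\<Pi>\<^sub>M j\<in>{..<k}. lborel). rho_integrand w k x y)"

end

theory Submission
  imports Defs
begin

text \<open>
  The Cayley transform expands the half-plane kernel into a power series with positive coefficients, so
  its matrices are positive semidefinite; Hadamard's inequality then puts the determinant between \<open>0\<close>
  and the product \<open>\<Prod>j. 1 / (4 \<pi> y\<^sub>j\<^sup>2)\<close> of its diagonal entries. Multiplied by the weights, this product is
  an integrable majorant independent of \<open>x\<close>; it yields the bounds on \<open>\<rho>\<close> and, by dominated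
  convergence, its continuity. For the density, factorial sums are written as sums over injective
  tuples of indices of the enumeration. Distinct indices carry independent uniform variables, so
  thinning multiplies each term by \<open>\<Prod>j. w (y\<^sub>j)\<close> in the mean, and Fubini's theorem integrates out
  the imaginary parts.
\<close>

text \<open>Points of \<open>Z\<close> with the same real part merge into a multiple point of the
  projection, which the moment measure counts through labels. Distinctness is therefore kept on
  indices: the same index tuples serve \<open>Z\<close>, its thinning and its projection, and
  coincidences of locations never have to be excluded. Positivity is more than a lower bound. The
  density is stated through \<open>ennreal\<close>, which sends negative reals to 0, and the heights
  are integrated out with nonnegative integrals; both steps rest on pointwise nonnegativity of the
  determinant, which the signed Leibniz sum does not show. The upper bound has exactly the right
  constant: on the diagonal, \<open>z - cnj z\<close> is twice \<open>\<i>\<close> times the height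
  \<open>y\<close>, so the kernel equals \<open>1 / (4 * pi * y\<^sup>2)\<close>, and the majorant
  factorises into \<open>k\<close> copies of the integrand of \<open>intensity w\<close>. Its growth
  as \<open>y\<close> tends to 0 is cut off by \<alpha> > 0.\<close>

section \<open>Hadamard's inequality for positive semidefinite matrices\<close>

text \<open>Symmetry is demanded at all natural indices and only the form is cut off at
  \<open>n\<close>, so symmetry passes to shifted families without side conditions.\<close>

definition psd_form :: "nat \<Rightarrow> (nat \<Rightarrow> nat \<Rightarrow> complex) \<Rightarrow> bool" where
  "psd_form n A \<longleftrightarrow> (\<forall>i j. cnj (A i j) = A j i) \<and>
     (\<forall>c. 0 \<le> Re (\<Sum>i<n. \<Sum>j<n. c i * cnj (c j) * A i j))"

text \<open>Isolates the positivity half, to be instantiated at specially chosen coefficient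
  vectors.\<close>

lemma psd_formD:
  assumes "psd_form n A"
  shows "0 \<le> Re (\<Sum>i<n. \<Sum>j<n. c i * cnj (c j) * A i j)"
  using assms unfolding psd_form_def by blast

text \<open>Every Leibniz product contains one entry of row 0. This serves the case of a vanishing
  pivot in \<open>hadamard_psd\<close>.\<close>

lemma det_first_row_zero:
  assumes "\<And>j. j < Suc n \<Longrightarrow> A 0 j = 0"
  shows "det (mat (Suc n) (Suc n) (\<lambda>(i, j). A i j)) = (0 :: complex)"
proof -
  have "(\<Prod>i = 0..<Suc n. mat (Suc n) (Suc n) (\<lambda>(i, j). A i j) $$ (i, p i)) = 0"
    if "p permutes {0..<Suc n}" for p
  proof (rule prod_zero)
    have "p 0 < Suc n"
      using permutes_in_image[OF that, of 0] by simp
    then show "\<exists>a\<in>{0..<Suc n}. mat (Suc n) (Suc n) (\<lambda>(i, j). A i j) $$ (a, p a) = 0"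
      using assms by (intro bexI[of _ 0]) auto
  qed simp
  then show ?thesis
    unfolding det_def'[OF mat_carrier]
    by (intro sum.neutral ballI) (simp only: mem_Collect_eq mult_zero_right)
qed

text \<open>One step of Gaussian elimination, written as a factorisation into a unit lower
  triangular matrix and a block upper triangular one.\<close>

lemma det_schur_complement:
  fixes A :: "nat \<Rightarrow> nat \<Rightarrow> complex"
  assumes "A 0 0 \<noteq> 0"
  shows "det (mat (Suc n) (Suc n) (\<lambda>(i, j). A i j)) =
    A 0 0 * det (mat n n (\<lambda>(i, j). A (Suc i) (Suc j) - A (Suc i) 0 * A 0 (Suc j) / A 0 0))"
proof -
  \<comment> \<open>\<open>L\<close> stores the elimination multipliers, all in column 0; row
    \<open>i\<close> thus has nonzero entries at most in columns 0 and \<open>i\<close>, which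
    collapses the matrix product below to two terms.\<close>
  define L where "L = mat (Suc n) (Suc n) (\<lambda>(i, j). if i = j then 1 else if j = 0 then A i 0 / A 0 0 else 0)"
  define S where "S = mat n n (\<lambda>(i, j). A (Suc i) (Suc j) - A (Suc i) 0 * A 0 (Suc j) / A 0 0)"
  define R where "R = four_block_mat (mat 1 1 (\<lambda>_. A 0 0)) (mat 1 n (\<lambda>(i, j). A 0 (Suc j))) (0\<^sub>m n 1) S"
  have R: "R \<in> carrier_mat (Suc n) (Suc n)"
    using four_block_carrier_mat[of "mat 1 1 (\<lambda>_. A 0 0)" 1 1 S n n] by (simp add: R_def S_def)
  have L: "L \<in> carrier_mat (Suc n) (Suc n)"
    unfolding L_def by simp
  have Ri: "R $$ (i, j) = (if i = 0 then A 0 j else if j = 0 then 0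
      else A i j - A i 0 * A 0 j / A 0 0)" if "i < Suc n" "j < Suc n" for i j
    using that unfolding R_def S_def by (auto simp: less_Suc_eq_0_disj)
  have "mat (Suc n) (Suc n) (\<lambda>(i, j). A i j) = L * R"
  proof (rule eq_matI)
    fix i j assume ij: "i < dim_row (L * R)" "j < dim_col (L * R)"
    then have i: "i < Suc n" and j: "j < Suc n"
      using L R by auto
    have "(L * R) $$ (i, j) = (\<Sum>k<Suc n. L $$ (i, k) * R $$ (k, j))"
      using L R i j by (simp add: scalar_prod_def atLeast0LessThan del: sum.lessThan_Suc)
    also have "\<dots> = (\<Sum>k\<in>{0, i}. L $$ (i, k) * R $$ (k, j))"
      using i by (intro sum.mono_neutral_right) (auto simp: L_def)
    also have "\<dots> = A i j"
      using i j assms by (cases "i = 0") (auto simp: L_def Ri)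
    finally show "mat (Suc n) (Suc n) (\<lambda>(i, j). A i j) $$ (i, j) = (L * R) $$ (i, j)"
      using i j by simp
  qed (use L R in auto)
  then have "det (mat (Suc n) (Suc n) (\<lambda>(i, j). A i j)) = det L * det R"
    using det_mult[OF L R] by simp
  moreover have "det L = 1"
  proof -
    have "det L = prod_list (diag_mat L)"
      by (rule det_lower_triangular[OF _ L]) (auto simp: L_def)
    also have "diag_mat L = map (\<lambda>_. 1) [0..<Suc n]"
      unfolding diag_mat_def using L by (intro map_cong) (auto simp: L_def)
    also have "prod_list \<dots> = 1"
      by (induction n) auto
    finally show ?thesis .
  qed
  moreover have "det R = A 0 0 * det S"
    unfolding R_def
    by (subst det_four_block_mat_lower_left_zero_col[where n = n])
      (auto simp: S_def det_single)
  ultimately show ?thesis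
    by (simp add: S_def)
qed

text \<open>The form is evaluated at the \<open>i\<close>-th unit vector.\<close>

lemma psd_form_diagonal:
  assumes "psd_form n A" "i < n"
  shows "A i i = of_real (Re (A i i))" "0 \<le> Re (A i i)"
proof -
  have "cnj (A i i) = A i i"
    using assms by (auto simp: psd_form_def)
  then show "A i i = of_real (Re (A i i))"
    by (simp add: complex_eq_iff)
  have "(\<Sum>k<n. \<Sum>l<n. of_bool (k = i) * cnj (of_bool (l = i)) * A k l)
      = (\<Sum>k\<in>{i}. \<Sum>l<n. of_bool (k = i) * cnj (of_bool (l = i)) * A k l)"
    using assms(2) by (intro sum.mono_neutral_right) auto
  also have "\<dots> = (\<Sum>k\<in>{i}. \<Sum>l\<in>{i}. of_bool (k = i) * cnj (of_bool (l = i)) * A k l)"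
    using assms(2) by (intro sum.cong refl sum.mono_neutral_right) auto
  also have "\<dots> = A i i"
    by simp
  finally show "0 \<le> Re (A i i)"
    using psd_formD[OF assms(1), of "\<lambda>k. of_bool (k = i)"] by (simp only:)
qed

text \<open>On the plane of coordinates 0 and \<open>Suc j\<close>, with the second coordinate fixed
  at 1, a zero pivot leaves the form affine in the first coordinate \<open>t\<close>. An affine
  function bounded below for all \<open>t\<close> has no linear part.\<close>

lemma psd_form_zero_row:
  assumes A: "psd_form (Suc n) A" and "A 0 0 = 0" "j < n"
  shows "A 0 (Suc j) = 0"
proof -
  define b where "b = A 0 (Suc j)"
  define d where "d = Re (A (Suc j) (Suc j))"
  have pos: "0 \<le> 2 * Re (t * b) + d" for t
  proof -
    define c where "c i = (if i = 0 then t else of_bool (i = Suc j))" for i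
    have b': "A (Suc j) 0 = cnj b"
      using A by (auto simp: psd_form_def b_def)
    have "(\<Sum>k<Suc n. \<Sum>l<Suc n. c k * cnj (c l) * A k l)
        = (\<Sum>k\<in>{0, Suc j}. \<Sum>l<Suc n. c k * cnj (c l) * A k l)"
      using assms(3) by (intro sum.mono_neutral_right) (auto simp: c_def)
    also have "\<dots> = (\<Sum>k\<in>{0, Suc j}. \<Sum>l\<in>{0, Suc j}. c k * cnj (c l) * A k l)"
      using assms(3) by (intro sum.cong refl sum.mono_neutral_right) (auto simp: c_def)
    also have "\<dots> = t * b + cnj (t * b) + A (Suc j) (Suc j)"
      using assms(2) by (simp add: c_def b_def[symmetric] b')
    finally have "Re (\<Sum>k<Suc n. \<Sum>l<Suc n. c k * cnj (c l) * A k l) = 2 * Re (t * b) + d"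
      by (simp add: d_def)
    then show ?thesis
      using psd_formD[OF A, of c] by (simp only:)
  qed
  \<comment> \<open>The choice of \<open>t\<close> aligns its phase against \<open>b\<close>, so
    that the linear term becomes \<open>- 2 * r * (cmod b)\<^sup>2\<close>.\<close>
  have *: "2 * r * (cmod b)\<^sup>2 \<le> d" for r :: real
    using pos[of "- of_real r * cnj b"]
    unfolding cmod_power2 by (simp add: algebra_simps power2_eq_square)
  show ?thesis
  proof (rule ccontr)
    assume "A 0 (Suc j) \<noteq> 0"
    then have "0 < (cmod b)\<^sup>2"
      by (simp add: b_def)
    then show False
      \<comment> \<open>This \<open>r\<close> makes the left-hand side equal to
        \<open>d + 1\<close>.\<close>
      using *[of "(d + 1) / (2 * (cmod b)\<^sup>2)"] by (simp add: field_simps)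
  qed
qed

text \<open>The Hermitian form of the Schur complement is that of \<open>A\<close> with the
  zeroth coordinate chosen so as to minimise it.\<close>

lemma psd_form_schur_complement:
  assumes A: "psd_form (Suc n) A" and nz: "A 0 0 \<noteq> 0"
  shows "psd_form n (\<lambda>i j. A (Suc i) (Suc j) - A (Suc i) 0 * A 0 (Suc j) / A 0 0)"
  unfolding psd_form_def
proof (intro conjI allI)
  have cnjA: "cnj (A i j) = A j i" for i j
    using A by (simp add: psd_form_def)
  show "cnj (A (Suc i) (Suc j) - A (Suc i) 0 * A 0 (Suc j) / A 0 0) =
      A (Suc j) (Suc i) - A (Suc j) 0 * A 0 (Suc i) / A 0 0" for i j
    by (simp add: cnjA)
  fix c :: "nat \<Rightarrow> complex"
  define a where "a = A 0 0"
  have cnja: "cnj a = a" and a0: "a \<noteq> 0"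
    using cnjA nz by (auto simp: a_def)
  define s where "s = (\<Sum>i<n. c i * A (Suc i) 0)"
  define t where "t = (\<Sum>j<n. cnj (c j) * A 0 (Suc j))"
  have t: "t = cnj s"
    by (simp add: s_def t_def cnjA)
  \<comment> \<open>Completing the square: since \<open>a\<close> is real and
    \<open>t = cnj s\<close>, the form is \<open>a\<close> times the squared modulus of
    \<open>r + s / a\<close>, plus \<open>Q - s * t / a\<close>.\<close>
  define r where "r = - s / a"
  define c' where "c' = case_nat r c"
  define Q where "Q = (\<Sum>i<n. \<Sum>j<n. c i * cnj (c j) * A (Suc i) (Suc j))"
  have "(\<Sum>k<Suc n. \<Sum>l<Suc n. c' k * cnj (c' l) * A k l)
      = r * cnj r * a + r * t + s * cnj r + Q"
    unfolding sum.lessThan_Suc_shift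
    by (simp add: c'_def s_def t_def Q_def a_def sum.distrib sum_distrib_left sum_distrib_right mult_ac)
  also have "\<dots> = Q - s * t / a"
    using a0 by (simp add: r_def t cnja)
  also have "\<dots> = (\<Sum>i<n. \<Sum>j<n. c i * cnj (c j) *
      (A (Suc i) (Suc j) - A (Suc i) 0 * A 0 (Suc j) / A 0 0))"
    unfolding Q_def s_def t_def sum_product
    by (simp add: a_def sum_subtractf sum_divide_distrib right_diff_distrib mult_ac)
  finally have eq: "(\<Sum>k<Suc n. \<Sum>l<Suc n. c' k * cnj (c' l) * A k l)
      = (\<Sum>i<n. \<Sum>j<n. c i * cnj (c j) *
      (A (Suc i) (Suc j) - A (Suc i) 0 * A 0 (Suc j) / A 0 0))" .
  show "0 \<le> Re (\<Sum>i<n. \<Sum>j<n. c i * cnj (c j) *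
      (A (Suc i) (Suc j) - A (Suc i) 0 * A 0 (Suc j) / A 0 0))"
    using psd_formD[OF A, of c'] unfolding eq .
qed

text \<open>Elimination splits off the pivot from the determinant and subtracts
  \<open>(cmod (A 0 (Suc i)))\<^sup>2 / a\<close> from each remaining diagonal entry, so both bounds
  are inherited from the Schur complement. A zero pivot forces a zero row, and the determinant
  vanishes.\<close>

lemma hadamard_psd:
  assumes "psd_form n A"
  shows "0 \<le> Re (det (mat n n (\<lambda>(i, j). A i j))) \<and>
    Re (det (mat n n (\<lambda>(i, j). A i j))) \<le> (\<Prod>i<n. Re (A i i))"
  using assms
proof (induction n arbitrary: A)
  case 0
  show ?case by (simp add: det_dim_zero)
next
  case (Suc n)
  note diag = psd_form_diagonal[OF Suc.prems]
  have prod: "(\<Prod>i<Suc n. Re (A i i)) = Re (A 0 0) * (\<Prod>i<n. Re (A (Suc i) (Suc i)))"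
    by (rule prod.lessThan_Suc_shift)
  have nonneg: "0 \<le> (\<Prod>i<n. Re (A (Suc i) (Suc i)))"
    by (intro prod_nonneg) (use diag(2) in auto)
  show ?case
  proof (cases "A 0 0 = 0")
    case True
    then have "det (mat (Suc n) (Suc n) (\<lambda>(i, j). A i j)) = 0"
      using psd_form_zero_row[OF Suc.prems True]
      by (intro det_first_row_zero) (auto simp: less_Suc_eq_0_disj)
    then show ?thesis
      unfolding prod using nonneg True by simp
  next
    case False
    define a where "a = Re (A 0 0)"
    have A00: "A 0 0 = of_real a" and a: "0 \<le> a"
      using diag[of 0] by (auto simp: a_def)
    let ?S = "\<lambda>i j. A (Suc i) (Suc j) - A (Suc i) 0 * A 0 (Suc j) / A 0 0"
    have S: "psd_form n ?S"
      by (rule psd_form_schur_complement[OF Suc.prems False])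
    have det: "Re (det (mat (Suc n) (Suc n) (\<lambda>(i, j). A i j)))
        = a * Re (det (mat n n (\<lambda>(i, j). ?S i j)))"
      using det_schur_complement[of A n] False by (simp add: A00)
    have "Re (?S i i) \<le> Re (A (Suc i) (Suc i))" for i
    proof -
      have "A (Suc i) 0 = cnj (A 0 (Suc i))"
        using Suc.prems by (simp add: psd_form_def)
      then have "A (Suc i) 0 * A 0 (Suc i) / A 0 0 = of_real ((cmod (A 0 (Suc i)))\<^sup>2 / a)"
        by (simp add: A00 complex_mult_cnj cmod_power2 mult.commute)
      then have "Re (A (Suc i) 0 * A 0 (Suc i) / A 0 0) = (cmod (A 0 (Suc i)))\<^sup>2 / a"
        by (simp only: Re_complex_of_real)
      then show ?thesis
        using a by simp
    qed
    then have "(\<Prod>i<n. Re (?S i i)) \<le> (\<Prod>i<n. Re (A (Suc i) (Suc i)))"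
      using psd_form_diagonal(2)[OF S] by (intro prod_mono) auto
    then have "Re (det (mat n n (\<lambda>(i, j). ?S i j))) \<le> (\<Prod>i<n. Re (A (Suc i) (Suc i)))"
      using Suc.IH[OF S] by linarith
    then show ?thesis
      unfolding prod det using Suc.IH[OF S] a
      by (auto simp: a_def[symmetric] intro!: mult_left_mono)
  qed
qed

section \<open>Positivity of the half-plane kernel\<close>

text \<open>Up to a factor \<open>g z * cnj (g \<zeta>)\<close>, which the coefficients of the form absorb, the kernel is
  \<open>1 / (1 - \<phi> z * cnj (\<phi> \<zeta>))\<^sup>2\<close> with \<open>\<phi>\<close> the Cayley transform.\<close>

lemma psd_form_kernel_H:
  assumes z: "\<And>i. i < n \<Longrightarrow> 0 < Im (z i)"
  shows "psd_form n (\<lambda>i j. kernel_H (z i) (z j))"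
  unfolding psd_form_def
proof (intro conjI allI)
  show "cnj (kernel_H (z i) (z j)) = kernel_H (z j) (z i)" for i j
    by (simp add: kernel_H_def power2_commute)
  fix c :: "nat \<Rightarrow> complex"
  define \<phi> where "\<phi> i = (z i - \<i>) / (z i + \<i>)" for i
  \<comment> \<open>Up to a constant of modulus one, \<open>2 / (z i + \<i>)\<^sup>2\<close> is the
    derivative of the Cayley transform, as the conformal covariance of the Bergman kernel dictates;
    the constant cancels in \<open>u i * cnj (u j)\<close>.\<close>
  define u where "u i = 2 * c i / (z i + \<i>)\<^sup>2" for i
  have nz: "z i + \<i> \<noteq> 0" if "i < n" for i
    using z[OF that] by (auto simp: complex_eq_iff)
  have "cmod (\<phi> i) < 1" if "i < n" for i
  proof -
    have "(cmod (z i - \<i>))\<^sup>2 < (cmod (z i + \<i>))\<^sup>2"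
      unfolding cmod_power2 using z[OF that] by (simp add: power2_eq_square algebra_simps)
    then have "cmod (z i - \<i>) < cmod (z i + \<i>)"
      by (rule power2_less_imp_less) simp
    then show ?thesis
      using nz[OF that] by (simp add: \<phi>_def norm_divide)
  qed
  then have "cmod (\<phi> i * cnj (\<phi> j)) < 1" if "i < n" "j < n" for i j
    using that mult_strict_mono[of "cmod (\<phi> i)" 1 "cmod (\<phi> j)" 1] by (simp add: norm_mult)
  \<comment> \<open>The differentiated geometric series; its coefficients \<open>Suc m\<close> are
    positive.\<close>
  then have sums: "(\<lambda>m. of_nat (Suc m) * (\<phi> i * cnj (\<phi> j)) ^ m) sums (1 / (1 - \<phi> i * cnj (\<phi> j))\<^sup>2)"
    if "i < n" "j < n" for i j
    using that by (intro geometric_deriv_sums)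
  have K: "c i * cnj (c j) * kernel_H (z i) (z j) =
      u i * cnj (u j) / of_real pi * (1 / (1 - \<phi> i * cnj (\<phi> j))\<^sup>2)" if ij: "i < n" "j < n" for i j
  proof -
    have nz': "cnj (z j) - \<i> \<noteq> 0"
      using nz[OF ij(2)] by (auto simp: complex_eq_iff)
    have "Im (z i - cnj (z j)) > 0"
      using z[OF ij(1)] z[OF ij(2)] by simp
    then have d: "z i - cnj (z j) \<noteq> 0"
      by auto
    have "1 - \<phi> i * cnj (\<phi> j) = - 2 * \<i> * (z i - cnj (z j)) / ((z i + \<i>) * (cnj (z j) - \<i>))"
      using nz[OF ij(1)] nz' by (simp add: \<phi>_def divide_simps) (simp add: algebra_simps)
    then have "(1 - \<phi> i * cnj (\<phi> j))\<^sup>2 =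
        - 4 * (z i - cnj (z j))\<^sup>2 / ((z i + \<i>)\<^sup>2 * (cnj (z j) - \<i>)\<^sup>2)"
      by (simp add: power_divide power_mult_distrib)
    then show ?thesis
      using nz[OF ij(1)] nz' d by (simp add: u_def kernel_H_def power2_eq_square)
  qed
  have "(\<lambda>m. \<Sum>i<n. \<Sum>j<n. u i * cnj (u j) / of_real pi * (of_nat (Suc m) * (\<phi> i * cnj (\<phi> j)) ^ m))
      sums (\<Sum>i<n. \<Sum>j<n. c i * cnj (c j) * kernel_H (z i) (z j))"
    by (intro sums_sum) (auto simp only: K lessThan_iff intro!: sums_mult sums)
  \<comment> \<open>Each power contributes a form of rank one, that is, a squared modulus with a
    positive coefficient.\<close>
  moreover have "(\<Sum>i<n. \<Sum>j<n. u i * cnj (u j) / of_real pi * (of_nat (Suc m) * (\<phi> i * cnj (\<phi> j)) ^ m))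
      = of_real (of_nat (Suc m) / pi * (cmod (\<Sum>i<n. u i * \<phi> i ^ m))\<^sup>2)" for m
  proof -
    have "(\<Sum>i<n. \<Sum>j<n. u i * cnj (u j) / of_real pi * (of_nat (Suc m) * (\<phi> i * cnj (\<phi> j)) ^ m))
      = of_nat (Suc m) / of_real pi * ((\<Sum>i<n. u i * \<phi> i ^ m) * cnj (\<Sum>i<n. u i * \<phi> i ^ m))"
      unfolding cnj_sum sum_product
      unfolding sum_distrib_left
      by (intro sum.cong refl) (simp add: power_mult_distrib mult_ac)
    then show ?thesis
      by (simp only: complex_norm_square[symmetric] of_real_mult of_real_divide of_real_of_nat_eq)
  qed
  ultimately have "(\<lambda>m. complex_of_real (of_nat (Suc m) / pi * (cmod (\<Sum>i<n. u i * \<phi> i ^ m))\<^sup>2))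
      sums (\<Sum>i<n. \<Sum>j<n. c i * cnj (c j) * kernel_H (z i) (z j))"
    by simp
  then have "(\<lambda>m. of_nat (Suc m) / pi * (cmod (\<Sum>i<n. u i * \<phi> i ^ m))\<^sup>2)
      sums Re (\<Sum>i<n. \<Sum>j<n. c i * cnj (c j) * kernel_H (z i) (z j))"
    using sums_Re by fastforce
  then show "0 \<le> Re (\<Sum>i<n. \<Sum>j<n. c i * cnj (c j) * kernel_H (z i) (z j))"
    by (rule sums_le[OF _ sums_zero, rotated]) simp
qed

text \<open>Hadamard's inequality with the diagonal evaluated: \<open>z - cnj z\<close> is purely
  imaginary of size \<open>2 * Im z\<close>, whence the factor 4 and the positive sign.\<close>

lemma kernel_det_H_bounds:
  assumes "\<And>j. j < k \<Longrightarrow> 0 < Im (z j)"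
  shows "0 \<le> kernel_det kernel_H k z" "kernel_det kernel_H k z \<le> (\<Prod>j<k. 1 / (4 * pi * (Im (z j))\<^sup>2))"
proof -
  have "Re (kernel_H (z j) (z j)) = 1 / (4 * pi * (Im (z j))\<^sup>2)" for j
  proof -
    have "kernel_H (z j) (z j) = of_real (1 / (4 * pi * (Im (z j))\<^sup>2))"
      by (simp add: kernel_H_def complex_diff_cnj power_mult_distrib)
    then show ?thesis
      by (simp only: Re_complex_of_real)
  qed
  then show "0 \<le> kernel_det kernel_H k z" "kernel_det kernel_H k z \<le> (\<Prod>j<k. 1 / (4 * pi * (Im (z j))\<^sup>2))"
    using hadamard_psd[OF psd_form_kernel_H, of k z] assms
    by (auto simp: kernel_det_def kernel_matrix_def)
qed

section \<open>Factorial sums of enumerated point processes\<close>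

text \<open>The labels attached to a point of multiplicity \<open>m\<close> are exactly as many as the indices at which
  an enumeration visits it; this also covers \<open>m = \<infinity>\<close>.\<close>

lemma ex_bij_betw_labelled_points:
  fixes \<zeta> :: "nat \<Rightarrow> 'a::t1_space"
  shows "\<exists>b. bij_betw b J (labelled_points (distr (count_space J) borel \<zeta>)) \<and> (\<forall>n\<in>J. fst (b n) = \<zeta> n)"
proof -
  define S where "S x = {n\<in>J. \<zeta> n = x}" for x
  \<comment> \<open>Each index is sent to its location together with its number within the fibre of
    indices at that location. The first component separates the fibres, so only bijectivity on each
    fibre is left to check.\<close>
  define b where "b n = (\<zeta> n, to_nat_on (S (\<zeta> n)) n)" for n
  let ?\<nu> = "distr (count_space J) borel \<zeta>"
  \<comment> \<open>Singletons are Borel because the space is T1.\<close>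
  have em: "emeasure ?\<nu> {x} = emeasure (count_space J) (S x)" for x
    by (subst emeasure_distr) (auto simp: S_def intro!: arg_cong2[where f = emeasure])
  have bij: "bij_betw (to_nat_on (S x)) (S x) {i. of_nat i < emeasure ?\<nu> {x}}" for x
  proof (cases "finite (S x)")
    case True
    then have "{i. of_nat i < emeasure ?\<nu> {x}} = {..<card (S x)}"
      unfolding em by (subst emeasure_count_space_finite) (auto simp: S_def)
    then show ?thesis
      using to_nat_on_finite[OF True] by simp
  next
    case False
    \<comment> \<open>An infinite fibre means multiplicity infinity, so every label occurs.\<close>
    then have "{i::nat. of_nat i < emeasure ?\<nu> {x}} = UNIV"
      unfolding em by (subst emeasure_count_space_infinite) (auto simp: S_def of_nat_less_top)
    then show ?thesis
      using to_nat_on_infinite[OF _ False] by simp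
  qed
  have "bij_betw b J (labelled_points ?\<nu>)"
    unfolding bij_betw_def
  proof
    show "inj_on b J"
    proof (rule inj_onI)
      fix m n assume mn: "m \<in> J" "n \<in> J" "b m = b n"
      then show "m = n"
        using bij_betw_imp_inj_on[OF bij, of "\<zeta> m"] by (auto simp: b_def S_def inj_on_def)
    qed
    show "b ` J = labelled_points ?\<nu>"
    proof (intro equalityI subsetI)
      fix y assume "y \<in> b ` J"
      then show "y \<in> labelled_points ?\<nu>"
        using bij_betwE[OF bij] by (auto simp: b_def S_def labelled_points_def)
    next
      fix y assume "y \<in> labelled_points ?\<nu>"
      then obtain x i where y: "y = (x, i)" "(x, i) \<in> labelled_points ?\<nu>"
        by (cases y) auto
      then have "i \<in> to_nat_on (S x) ` S x"
        using bij_betw_imp_surj_on[OF bij, of x] by (auto simp: labelled_points_def)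
      then obtain n where "n \<in> S x" "i = to_nat_on (S x) n"
        by auto
      then show "y \<in> b ` J"
        by (auto simp: y b_def S_def)
    qed
  qed
  then show ?thesis
    by (intro exI[of _ b]) (simp add: b_def)
qed

text \<open>The entries range over all naturals, not over the random index set. Membership in the
  latter becomes an indicator factor, so the sum has a deterministic countable domain and can be
  exchanged with the expectation.\<close>

definition injective_tuples :: "nat \<Rightarrow> (nat \<Rightarrow> nat) set" where
  "injective_tuples k = {p \<in> {..<k} \<rightarrow>\<^sub>E UNIV. inj_on p {..<k}}"

lemma countable_injective_tuples [simp]: "countable (injective_tuples k)"
  unfolding injective_tuples_def
  by (rule countable_subset[of _ "{..<k} \<rightarrow>\<^sub>E UNIV"]) (auto intro!: countable_PiE)

lemma sigma_finite_injective_tuples: "sigma_finite_measure (count_space (injective_tuples k))"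
  by (intro sigma_finite_measure_count_space_countable countable_injective_tuples)

lemma bij_betw_injective_tuples:
  assumes b: "bij_betw b J L"
  shows "bij_betw (\<lambda>p. \<lambda>j\<in>{..<k}. b (p j)) {p \<in> {..<k} \<rightarrow>\<^sub>E J. inj_on p {..<k}}
    {p \<in> {..<k} \<rightarrow>\<^sub>E L. inj_on p {..<k}}"
proof (rule bij_betw_byWitness[where f' = "\<lambda>p. \<lambda>j\<in>{..<k}. inv_into J b (p j)"])
  note inj = bij_betw_imp_inj_on[OF b] and surj = bij_betw_imp_surj_on[OF b]
  show "\<forall>p\<in>{p \<in> {..<k} \<rightarrow>\<^sub>E J. inj_on p {..<k}}.
      (\<lambda>j\<in>{..<k}. inv_into J b ((\<lambda>j\<in>{..<k}. b (p j)) j)) = p"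
    using inj by (auto simp: PiE_iff extensional_def fun_eq_iff)
  show "\<forall>p\<in>{p \<in> {..<k} \<rightarrow>\<^sub>E L. inj_on p {..<k}}.
      (\<lambda>j\<in>{..<k}. b ((\<lambda>j\<in>{..<k}. inv_into J b (p j)) j)) = p"
    using surj by (auto simp: PiE_iff extensional_def fun_eq_iff intro!: f_inv_into_f)
  show "(\<lambda>p. \<lambda>j\<in>{..<k}. b (p j)) ` {p \<in> {..<k} \<rightarrow>\<^sub>E J. inj_on p {..<k}}
      \<subseteq> {p \<in> {..<k} \<rightarrow>\<^sub>E L. inj_on p {..<k}}"
    using inj surj by (auto simp: PiE_iff inj_on_def)
  show "(\<lambda>p. \<lambda>j\<in>{..<k}. inv_into J b (p j)) ` {p \<in> {..<k} \<rightarrow>\<^sub>E L. inj_on p {..<k}}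
      \<subseteq> {p \<in> {..<k} \<rightarrow>\<^sub>E J. inj_on p {..<k}}"
  proof (rule image_subsetI)
    fix p assume "p \<in> {p \<in> {..<k} \<rightarrow>\<^sub>E L. inj_on p {..<k}}"
    then have p: "inj_on p {..<k}" "\<And>j. j < k \<Longrightarrow> p j \<in> b ` J"
      using surj by (auto simp: PiE_iff)
    have "inj_on (\<lambda>j\<in>{..<k}. inv_into J b (p j)) {..<k}"
    proof (rule inj_onI)
      fix i j assume "i \<in> {..<k}" "j \<in> {..<k}"
        "(\<lambda>j\<in>{..<k}. inv_into J b (p j)) i = (\<lambda>j\<in>{..<k}. inv_into J b (p j)) j"
      then show "i = j"
        using p inv_into_injective[of J b "p i" "p j"] by (auto simp: inj_on_def)
    qed
    then show "(\<lambda>j\<in>{..<k}. inv_into J b (p j)) \<in> {p \<in> {..<k} \<rightarrow>\<^sub>E J. inj_on p {..<k}}"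
      using p(2) by (auto simp: inv_into_into)
  qed
qed

text \<open>\<open>F\<close> sees only locations, so the arbitrary numbering inside the fibres has
  no effect once labelled points are replaced by indices.\<close>

lemma factorial_sum_distr_count_space:
  fixes \<zeta> :: "nat \<Rightarrow> 'a::t1_space"
  shows "factorial_sum k (distr (count_space J) borel \<zeta>) F =
    (\<integral>\<^sup>+ p. (\<Prod>j<k. indicator J (p j)) * F (\<lambda>j\<in>{..<k}. \<zeta> (p j)) \<partial>count_space (injective_tuples k))"
proof -
  obtain b where b: "bij_betw b J (labelled_points (distr (count_space J) borel \<zeta>))"
    and fst_b: "\<And>n. n \<in> J \<Longrightarrow> fst (b n) = \<zeta> n"
    using ex_bij_betw_labelled_points[of J \<zeta>] by blast
  let ?T = "{p \<in> {..<k} \<rightarrow>\<^sub>E J. inj_on p {..<k}}"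
  have sub: "?T \<subseteq> injective_tuples k"
    by (auto simp: injective_tuples_def PiE_iff)
  have "factorial_sum k (distr (count_space J) borel \<zeta>) F =
      (\<integral>\<^sup>+ p. F (\<lambda>j\<in>{..<k}. fst ((\<lambda>j\<in>{..<k}. b (p j)) j)) \<partial>count_space ?T)"
    unfolding factorial_sum_def
    by (rule nn_integral_bij_count_space[OF bij_betw_injective_tuples[OF b], symmetric])
  also have "\<dots> = (\<integral>\<^sup>+ p. F (\<lambda>j\<in>{..<k}. \<zeta> (p j)) \<partial>count_space ?T)"
    by (intro nn_integral_cong arg_cong[where f = F]) (auto simp: fst_b PiE_iff)
  also have "\<dots> = (\<integral>\<^sup>+ p. F (\<lambda>j\<in>{..<k}. \<zeta> (p j)) * indicator ?T p \<partial>count_space (injective_tuples k))"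
    using sub by (subst nn_integral_restrict_space[symmetric])
      (auto simp: restrict_count_space Int_absorb2)
  also have "\<dots> = (\<integral>\<^sup>+ p. (\<Prod>j<k. indicator J (p j)) * F (\<lambda>j\<in>{..<k}. \<zeta> (p j))
      \<partial>count_space (injective_tuples k))"
  proof (intro nn_integral_cong)
    fix p assume "p \<in> space (count_space (injective_tuples k))"
    then have "(\<Prod>j<k. indicator J (p j)) = (indicator ?T p :: ennreal)"
      by (auto simp: injective_tuples_def PiE_iff indicator_def prod_eq_1_iff intro!: prod.neutral prod_zero)
    then show "F (\<lambda>j\<in>{..<k}. \<zeta> (p j)) * indicator ?T p =
        (\<Prod>j<k. indicator J (p j)) * F (\<lambda>j\<in>{..<k}. \<zeta> (p j))"
      by (simp add: mult.commute)
  qed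
  finally show ?thesis .
qed

text \<open>\<open>factorial_moment_measure\<close> applies \<open>measure_of\<close> to a set
  function whose countable additivity is not given. Here the same set function appears as the image
  of a measure with density on tuples and outcomes, where additivity is automatic.\<close>

definition tuple_measure ::
    "'w measure \<Rightarrow> nat \<Rightarrow> ('w \<Rightarrow> nat set) \<Rightarrow> (nat \<Rightarrow> 'w \<Rightarrow> 'a::topological_space) \<Rightarrow> (nat \<Rightarrow> 'a) measure" where
  "tuple_measure P k I \<zeta> =
     distr (density (count_space (injective_tuples k) \<Otimes>\<^sub>M P) (\<lambda>(p, \<omega>). \<Prod>j<k. indicator (I \<omega>) (p j)))
       (\<Pi>\<^sub>M j\<in>{..<k}. borel) (\<lambda>(p, \<omega>). \<lambda>j\<in>{..<k}. \<zeta> (p j) \<omega>)"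

section \<open>Campbell's formula for enumerated processes\<close>

lemma
  fixes \<zeta> :: "nat \<Rightarrow> 'w \<Rightarrow> 'a::topological_space"
  assumes D: "(\<lambda>\<omega> n. (n \<in> I \<omega>, \<zeta> n \<omega>)) \<in> measurable P (\<Pi>\<^sub>M n\<in>UNIV. count_space UNIV \<Otimes>\<^sub>M borel)"
  shows measurable_enumeration_mem: "Measurable.pred P (\<lambda>\<omega>. n \<in> I \<omega>)"
    and measurable_enumeration_point: "\<zeta> n \<in> borel_measurable P"
proof -
  have *: "(\<lambda>\<omega>. (n \<in> I \<omega>, \<zeta> n \<omega>)) \<in> measurable P (count_space UNIV \<Otimes>\<^sub>M borel)"
    using measurable_compose[OF D measurable_component_singleton[of n]] by simp
  show "Measurable.pred P (\<lambda>\<omega>. n \<in> I \<omega>)"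
    using measurable_compose[OF * measurable_fst] by simp
  show "\<zeta> n \<in> borel_measurable P"
    using measurable_compose[OF * measurable_snd] by simp
qed

text \<open>Tonelli's theorem on tuples and outcomes. In the first form the tuple is fixed inside
  the expectation, which is where thinning is computed; the second identifies the moment
  measure.\<close>

lemma nn_integral_factorial_sum_enumeration:
  fixes \<zeta> :: "nat \<Rightarrow> 'w \<Rightarrow> 'a::t1_space"
  assumes "sigma_finite_measure P"
    and I [measurable]: "\<And>n. Measurable.pred P (\<lambda>\<omega>. n \<in> I \<omega>)"
    and \<zeta> [measurable]: "\<And>n. \<zeta> n \<in> borel_measurable P"
    and X: "\<And>\<omega>. \<omega> \<in> space P \<Longrightarrow> X \<omega> = distr (count_space (I \<omega>)) borel (\<lambda>n. \<zeta> n \<omega>)"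
    and F [measurable]: "F \<in> borel_measurable (\<Pi>\<^sub>M j\<in>{..<k}. borel)"
  shows "(\<integral>\<^sup>+ \<omega>. factorial_sum k (X \<omega>) F \<partial>P) =
      (\<integral>\<^sup>+ p. \<integral>\<^sup>+ \<omega>. (\<Prod>j<k. indicator (I \<omega>) (p j)) * F (\<lambda>j\<in>{..<k}. \<zeta> (p j) \<omega>) \<partial>P
        \<partial>count_space (injective_tuples k))" (is "_ = ?R")
    and "(\<integral>\<^sup>+ \<omega>. factorial_sum k (X \<omega>) F \<partial>P) = (\<integral>\<^sup>+ x. F x \<partial>tuple_measure P k I \<zeta>)"
proof -
  let ?C = "count_space (injective_tuples k)"
  interpret P: sigma_finite_measure P by fact
  interpret C: sigma_finite_measure ?C by (rule sigma_finite_injective_tuples)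
  interpret CP: pair_sigma_finite ?C P ..
  have ind [measurable]: "(\<lambda>\<omega>. indicator (I \<omega>) n :: ennreal) \<in> borel_measurable P" for n
    unfolding indicator_def by measurable
  \<comment> \<open>As the tuples are countable, joint measurability reduces to measurability in the
    outcome for each fixed tuple.\<close>
  have m1: "(\<lambda>(p, \<omega>). \<Prod>j<k. indicator (I \<omega>) (p j) :: ennreal) \<in> borel_measurable (?C \<Otimes>\<^sub>M P)"
    by (rule measurable_pair_measure_countable1) auto
  have m2: "(\<lambda>(p, \<omega>). \<lambda>j\<in>{..<k}. \<zeta> (p j) \<omega>) \<in> measurable (?C \<Otimes>\<^sub>M P) (\<Pi>\<^sub>M j\<in>{..<k}. borel)"
    by (rule measurable_pair_measure_countable1) auto
  have m3: "(\<lambda>(p, \<omega>). (\<Prod>j<k. indicator (I \<omega>) (p j)) * F (\<lambda>j\<in>{..<k}. \<zeta> (p j) \<omega>))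
      \<in> borel_measurable (?C \<Otimes>\<^sub>M P)"
    by (rule measurable_pair_measure_countable1) auto
  have "(\<integral>\<^sup>+ \<omega>. factorial_sum k (X \<omega>) F \<partial>P) =
      (\<integral>\<^sup>+ \<omega>. \<integral>\<^sup>+ p. (\<Prod>j<k. indicator (I \<omega>) (p j)) * F (\<lambda>j\<in>{..<k}. \<zeta> (p j) \<omega>) \<partial>?C \<partial>P)"
    by (intro nn_integral_cong) (simp add: X factorial_sum_distr_count_space)
  also have "\<dots> = ?R"
    using CP.Fubini'[OF m3] by simp
  finally show 1: "(\<integral>\<^sup>+ \<omega>. factorial_sum k (X \<omega>) F \<partial>P) = ?R" .
  also have "\<dots> = (\<integral>\<^sup>+ z. (\<lambda>(p, \<omega>). (\<Prod>j<k. indicator (I \<omega>) (p j)) * F (\<lambda>j\<in>{..<k}. \<zeta> (p j) \<omega>)) z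
      \<partial>(?C \<Otimes>\<^sub>M P))"
    using P.nn_integral_fst[OF m3] by simp
  also have "\<dots> = (\<integral>\<^sup>+ x. F x \<partial>tuple_measure P k I \<zeta>)"
    unfolding tuple_measure_def using m1 m2 m3
    by (subst nn_integral_distr)
      (auto simp: nn_integral_density measurable_compose[OF m2 F] split_beta')
  finally show "(\<integral>\<^sup>+ \<omega>. factorial_sum k (X \<omega>) F \<partial>P) = (\<integral>\<^sup>+ x. F x \<partial>tuple_measure P k I \<zeta>)" .
qed

lemma factorial_moment_measure_eq_tuple_measure:
  fixes \<zeta> :: "nat \<Rightarrow> 'w \<Rightarrow> 'a::t1_space"
  assumes "sigma_finite_measure P"
    and "\<And>n. Measurable.pred P (\<lambda>\<omega>. n \<in> I \<omega>)"
    and "\<And>n. \<zeta> n \<in> borel_measurable P"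
    and "\<And>\<omega>. \<omega> \<in> space P \<Longrightarrow> X \<omega> = distr (count_space (I \<omega>)) borel (\<lambda>n. \<zeta> n \<omega>)"
  shows "factorial_moment_measure P X k = tuple_measure P k I \<zeta>"
proof -
  let ?T = "tuple_measure P k I \<zeta>"
  have sp: "space ?T = {..<k} \<rightarrow>\<^sub>E UNIV" and st: "sets ?T = sets (\<Pi>\<^sub>M j\<in>{..<k}. borel)"
    by (simp_all add: tuple_measure_def space_PiM)
  have "factorial_moment_measure P X k = measure_of (space ?T) (sets ?T) (emeasure ?T)"
    unfolding factorial_moment_measure_def sp[symmetric] st[symmetric]
  proof (rule measure_of_eq)
    show "sets ?T \<subseteq> Pow (space ?T)"
      by (rule sets.space_closed)
    fix A assume "A \<in> sigma_sets (space ?T) (sets ?T)"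
    then have A: "A \<in> sets ?T"
      by (simp add: sets.sigma_sets_eq)
    then have "indicator A \<in> borel_measurable (\<Pi>\<^sub>M j\<in>{..<k}. borel)"
      unfolding st by measurable
    from nn_integral_factorial_sum_enumeration(2)[OF assms this]
    show "(\<integral>\<^sup>+ \<omega>. factorial_sum k (X \<omega>) (indicator A) \<partial>P) = emeasure ?T A"
      using A by simp
  qed
  then show ?thesis
    by (simp add: measure_of_of_measure)
qed

text \<open>Campbell's formula: it passes from indicators, which define the moment measure, to all
  nonnegative measurable \<open>F\<close>.\<close>

lemma nn_integral_factorial_sum:
  fixes \<zeta> :: "nat \<Rightarrow> 'w \<Rightarrow> 'a::t1_space"
  assumes "sigma_finite_measure P"
    and "\<And>n. Measurable.pred P (\<lambda>\<omega>. n \<in> I \<omega>)"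
    and "\<And>n. \<zeta> n \<in> borel_measurable P"
    and "\<And>\<omega>. \<omega> \<in> space P \<Longrightarrow> X \<omega> = distr (count_space (I \<omega>)) borel (\<lambda>n. \<zeta> n \<omega>)"
    and "F \<in> borel_measurable (\<Pi>\<^sub>M j\<in>{..<k}. borel)"
  shows "(\<integral>\<^sup>+ \<omega>. factorial_sum k (X \<omega>) F \<partial>P) = (\<integral>\<^sup>+ x. F x \<partial>factorial_moment_measure P X k)"
  using nn_integral_factorial_sum_enumeration(2)[OF assms]
    factorial_moment_measure_eq_tuple_measure[OF assms(1-4)] by simp

section \<open>Independent thinning\<close>

text \<open>The library's \<open>indep_var\<close> would force both variables to have the same range type.\<close>

lemma (in prob_space) distr_pair_of_indep_set:
  assumes X: "random_variable S X" and Y: "random_variable T Y"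
    and indep: "indep_set (sets (vimage_algebra (space M) X S)) (sets (vimage_algebra (space M) Y T))"
  shows "distr M S X \<Otimes>\<^sub>M distr M T Y = distr M (S \<Otimes>\<^sub>M T) (\<lambda>\<omega>. (X \<omega>, Y \<omega>))"
proof (rule pair_measure_eqI)
  show "sigma_finite_measure (distr M S X)" "sigma_finite_measure (distr M T Y)"
    using prob_space_distr[OF X] prob_space_distr[OF Y] by (auto intro: prob_space_imp_sigma_finite)
  show "sets (distr M S X \<Otimes>\<^sub>M distr M T Y) = sets (distr M (S \<Otimes>\<^sub>M T) (\<lambda>\<omega>. (X \<omega>, Y \<omega>)))"
    by simp
  fix A B assume "A \<in> sets (distr M S X)" "B \<in> sets (distr M T Y)"
  then have A: "A \<in> sets S" and B: "B \<in> sets T"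
    by simp_all
  have "prob ((X -` A \<inter> space M) \<inter> (Y -` B \<inter> space M)) = prob (X -` A \<inter> space M) * prob (Y -` B \<inter> space M)"
    using A B by (intro indep_setD[OF indep] in_vimage_algebra)
  moreover have "(\<lambda>\<omega>. (X \<omega>, Y \<omega>)) -` (A \<times> B) \<inter> space M = (X -` A \<inter> space M) \<inter> (Y -` B \<inter> space M)"
    by auto
  ultimately show "emeasure (distr M S X) A * emeasure (distr M T Y) B
      = emeasure (distr M (S \<Otimes>\<^sub>M T) (\<lambda>\<omega>. (X \<omega>, Y \<omega>))) (A \<times> B)"
    using X Y A B by (simp add: emeasure_distr emeasure_eq_measure ennreal_mult)
qed

text \<open>Injectivity of \<open>p\<close> selects \<open>k\<close> different coordinates, so the
  selected uniform variables are again independent. Each lies below \<open>q j\<close> with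
  probability exactly \<open>q j\<close> because \<open>q j\<close> is in the unit interval.\<close>

lemma nn_integral_PiM_uniform_less:
  fixes p :: "nat \<Rightarrow> 'i"
  assumes p: "inj_on p {..<k}" and q: "\<And>j. j < k \<Longrightarrow> 0 \<le> q j" "\<And>j. j < k \<Longrightarrow> q j \<le> (1 :: real)"
  shows "(\<integral>\<^sup>+ u. (\<Prod>j<k. indicator {..<q j} (u (p j))) \<partial>(\<Pi>\<^sub>M n\<in>UNIV. uniform_measure lborel {0..1}))
    = (\<Prod>j<k. ennreal (q j))"
proof -
  let ?u = "uniform_measure lborel {0..1::real}"
  have prob: "prob_space ?u"
    by (rule prob_space_uniform_measure) auto
  interpret product_sigma_finite "\<lambda>_::nat. ?u"
    by (simp add: product_sigma_finite_def prob prob_space_imp_sigma_finite)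
  have reindex: "distr (\<Pi>\<^sub>M n\<in>UNIV. ?u) (\<Pi>\<^sub>M j\<in>{..<k}. ?u) (\<lambda>u. \<lambda>j\<in>{..<k}. u (p j)) = (\<Pi>\<^sub>M j\<in>{..<k}. ?u)"
    by (rule distr_PiM_reindex[OF prob p]) auto
  have "(\<integral>\<^sup>+ u. (\<Prod>j<k. indicator {..<q j} (u (p j))) \<partial>(\<Pi>\<^sub>M n\<in>UNIV. ?u))
      = (\<integral>\<^sup>+ v. (\<Prod>j<k. indicator {..<q j} (v j))
          \<partial>distr (\<Pi>\<^sub>M n\<in>UNIV. ?u) (\<Pi>\<^sub>M j\<in>{..<k}. ?u) (\<lambda>u. \<lambda>j\<in>{..<k}. u (p j)))"
    by (subst nn_integral_distr) (auto intro!: nn_integral_cong)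
  also have "\<dots> = (\<Prod>j<k. \<integral>\<^sup>+ t. indicator {..<q j} t \<partial>?u)"
    unfolding reindex by (rule product_nn_integral_prod) auto
  also have "\<dots> = (\<Prod>j<k. ennreal (q j))"
  proof (rule prod.cong)
    fix j assume "j \<in> {..<k}"
    then have "{0..1} \<inter> {..<q j} = {0..<q j}"
      using q[of j] by auto
    then show "(\<integral>\<^sup>+ t. indicator {..<q j} t \<partial>?u) = ennreal (q j)"
      using q[of j] \<open>j \<in> {..<k}\<close> by (simp add: divide_ennreal_def)
  qed simp
  finally show ?thesis .
qed

text \<open>This is conditioning on the enumerated process, carried out without conditional
  expectations: by independence the joint law of marks and process is a product, and Fubini's
  theorem applies.\<close>

lemma (in prob_space) nn_integral_thinned_tuple:
  fixes \<zeta> :: "nat \<Rightarrow> 'a \<Rightarrow> 'b::topological_space" and U :: "nat \<Rightarrow> 'a \<Rightarrow> real" and I :: "'a \<Rightarrow> nat set" and k :: nat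
  assumes U: "indep_vars (\<lambda>_. borel) U UNIV"
    and unif: "\<And>n. distr M borel (U n) = uniform_measure lborel {0..1}"
    and D: "(\<lambda>\<omega> n. (n \<in> I \<omega>, \<zeta> n \<omega>)) \<in> measurable M (\<Pi>\<^sub>M n\<in>UNIV. count_space UNIV \<Otimes>\<^sub>M borel)"
    and indep: "indep_set
          (sets (vimage_algebra (space M) (\<lambda>\<omega> n. U n \<omega>) (\<Pi>\<^sub>M n\<in>UNIV. borel)))
          (sets (vimage_algebra (space M) (\<lambda>\<omega> n. (n \<in> I \<omega>, \<zeta> n \<omega>))
             (\<Pi>\<^sub>M n\<in>UNIV. count_space UNIV \<Otimes>\<^sub>M borel)))"
    and q [measurable]: "q \<in> borel_measurable borel" and q01: "\<And>z. 0 \<le> q z" "\<And>z. q z \<le> 1"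
    and F [measurable]: "F \<in> borel_measurable (\<Pi>\<^sub>M j\<in>{..<k}. borel)"
    and p: "inj_on p {..<k}"
  shows "(\<integral>\<^sup>+ \<omega>. (\<Prod>j<k. indicator {n \<in> I \<omega>. U n \<omega> < q (\<zeta> n \<omega>)} (p j)) * F (\<lambda>j\<in>{..<k}. \<zeta> (p j) \<omega>) \<partial>M)
    = (\<integral>\<^sup>+ \<omega>. (\<Prod>j<k. indicator (I \<omega>) (p j)) *
        ((\<Prod>j<k. ennreal (q (\<zeta> (p j) \<omega>))) * F (\<lambda>j\<in>{..<k}. \<zeta> (p j) \<omega>)) \<partial>M)"
proof -
  define L where "L = (\<Pi>\<^sub>M n\<in>(UNIV::nat set). borel :: real measure)"
  define N where "N = (\<Pi>\<^sub>M n\<in>(UNIV::nat set). count_space (UNIV::bool set) \<Otimes>\<^sub>M (borel :: 'b measure))"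
  define V where "V \<omega> n = U n \<omega>" for \<omega> n
  define E where "E \<omega> n = (n \<in> I \<omega>, \<zeta> n \<omega>)" for \<omega> n
  have U_rv: "U n \<in> borel_measurable M" for n
    using U by (auto simp: indep_vars_def)
  have V_eq: "V = (\<lambda>\<omega>. \<lambda>n\<in>UNIV. U n \<omega>)"
    by (auto simp: V_def fun_eq_iff)
  have V: "V \<in> measurable M L"
    unfolding V_eq L_def by (intro measurable_restrict U_rv)
  have E: "E \<in> measurable M N"
    using D unfolding N_def E_def[abs_def] .
  have "distr M L V = (\<Pi>\<^sub>M n\<in>UNIV. distr M borel (U n))"
    using indep_vars_iff_distr_eq_PiM[where I = UNIV and M' = "\<lambda>_. borel" and X = U] U U_rv unfolding V_eq L_def by auto
  then have dV: "distr M L V = (\<Pi>\<^sub>M n\<in>UNIV. uniform_measure lborel {0..1})"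
    by (simp add: unif)
  have joint: "distr M L V \<Otimes>\<^sub>M distr M N E = distr M (L \<Otimes>\<^sub>M N) (\<lambda>\<omega>. (V \<omega>, E \<omega>))"
    using indep V E unfolding L_def N_def V_def[abs_def] E_def[abs_def]
    by (intro distr_pair_of_indep_set)
  interpret V: prob_space "distr M L V" by (rule prob_space_distr[OF V])
  interpret E: prob_space "distr M N E" by (rule prob_space_distr[OF E])
  interpret VE: pair_sigma_finite "distr M L V" "distr M N E" ..
  have uc [measurable]: "(\<lambda>u. u n) \<in> borel_measurable L" for n
    unfolding L_def by measurable
  have ec [measurable]: "(\<lambda>e. e n) \<in> measurable N (count_space UNIV \<Otimes>\<^sub>M borel)" for n
    unfolding N_def by measurable
  have fst_m [measurable]: "Measurable.pred N (\<lambda>e. fst (e n))" for n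
    using measurable_compose[OF ec measurable_fst] by simp
  have snd_m [measurable]: "(\<lambda>e. snd (e n)) \<in> borel_measurable N" for n
    using measurable_compose[OF ec measurable_snd] .
  have ind_m [measurable]: "(\<lambda>e. of_bool (fst (e n)) :: ennreal) \<in> borel_measurable N" for n
    unfolding of_bool_def by measurable
  have ind2_m [measurable]: "(\<lambda>(u, e). indicator {..<q (snd (e n))} (u n) :: ennreal) \<in> borel_measurable (L \<Otimes>\<^sub>M N)" for n
    unfolding indicator_def lessThan_iff by measurable
  \<comment> \<open>\<open>G\<close> collects the part that depends on the process alone; the marks
    enter \<open>f\<close> only through the retention events.\<close>
  define G where "G e = (\<Prod>j<k. of_bool (fst (e (p j)))) * F (\<lambda>j\<in>{..<k}. snd (e (p j)))" for e
  have G [measurable]: "G \<in> borel_measurable N"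
    unfolding G_def by measurable
  define f where "f = (\<lambda>(u, e). (\<Prod>j<k. indicator {..<q (snd (e (p j)))} (u (p j))) * G e)"
  have f: "f \<in> borel_measurable (L \<Otimes>\<^sub>M N)"
    unfolding f_def by measurable
  have "(\<integral>\<^sup>+ \<omega>. (\<Prod>j<k. indicator {n \<in> I \<omega>. U n \<omega> < q (\<zeta> n \<omega>)} (p j)) * F (\<lambda>j\<in>{..<k}. \<zeta> (p j) \<omega>) \<partial>M)
      = (\<integral>\<^sup>+ \<omega>. f (V \<omega>, E \<omega>) \<partial>M)"
    by (intro nn_integral_cong)
      (auto simp: f_def G_def V_def E_def prod.distrib[symmetric] mult.assoc[symmetric] indicator_def
        intro!: arg_cong2[where f = "(*)"] prod.cong)
  also have "\<dots> = (\<integral>\<^sup>+ z. f z \<partial>(distr M L V \<Otimes>\<^sub>M distr M N E))"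
    unfolding joint using V E f by (subst nn_integral_distr) auto
  \<comment> \<open>The marks are integrated first. With the process \<open>e\<close> frozen, the
    retention thresholds are constants.\<close>
  also have "\<dots> = (\<integral>\<^sup>+ e. \<integral>\<^sup>+ u. f (u, e) \<partial>distr M L V \<partial>distr M N E)"
    using f by (intro VE.nn_integral_snd[symmetric]) simp
  also have "\<dots> = (\<integral>\<^sup>+ e. (\<Prod>j<k. ennreal (q (snd (e (p j))))) * G e \<partial>distr M N E)"
  proof (intro nn_integral_cong)
    fix e
    have "(\<integral>\<^sup>+ u. f (u, e) \<partial>distr M L V)
        = (\<integral>\<^sup>+ u. (\<Prod>j<k. indicator {..<q (snd (e (p j)))} (u (p j))) \<partial>distr M L V) * G e"
      unfolding f_def by (simp add: nn_integral_multc)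
    also have "(\<integral>\<^sup>+ u. (\<Prod>j<k. indicator {..<q (snd (e (p j)))} (u (p j))) \<partial>distr M L V)
        = (\<Prod>j<k. ennreal (q (snd (e (p j)))))"
      unfolding dV by (rule nn_integral_PiM_uniform_less[OF p]) (auto simp: q01)
    finally show "(\<integral>\<^sup>+ u. f (u, e) \<partial>distr M L V) = (\<Prod>j<k. ennreal (q (snd (e (p j))))) * G e" .
  qed
  also have "\<dots> = (\<integral>\<^sup>+ \<omega>. (\<Prod>j<k. ennreal (q (snd (E \<omega> (p j))))) * G (E \<omega>) \<partial>M)"
    using E by (subst nn_integral_distr) auto
  also have "\<dots> = (\<integral>\<^sup>+ \<omega>. (\<Prod>j<k. indicator (I \<omega>) (p j)) *
        ((\<Prod>j<k. ennreal (q (\<zeta> (p j) \<omega>))) * F (\<lambda>j\<in>{..<k}. \<zeta> (p j) \<omega>)) \<partial>M)"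
    by (intro nn_integral_cong) (simp add: E_def G_def mult_ac indicator_def of_bool_def)
  finally show ?thesis .
qed

text \<open>Mapping by \<open>h\<close> changes only the locations attached to indices, and thinning
  only the random index set, so both processes are summed over the same tuples. Points that
  \<open>h\<close> merges remain separate tuples, as the multiplicities of the image measure
  require.\<close>

lemma nn_integral_thinned_factorial_sum:
  fixes Z :: "'w \<Rightarrow> 'a::t1_space measure" and h :: "'a \<Rightarrow> 'b::t1_space"
  assumes P: "prob_space P"
    and thin: "independent_thinning P q Z M"
    and q [measurable]: "q \<in> borel_measurable borel" and q01: "\<And>z. 0 \<le> q z" "\<And>z. q z \<le> 1"
    and h [measurable]: "h \<in> borel_measurable borel"
    and A [measurable]: "A \<in> sets (\<Pi>\<^sub>M j\<in>{..<k}. borel)"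
  shows "emeasure (factorial_moment_measure P (\<lambda>\<omega>. distr (M \<omega>) borel h) k) A
    = (\<integral>\<^sup>+ z. (\<Prod>j<k. ennreal (q (z j))) * indicator A (\<lambda>j\<in>{..<k}. h (z j))
        \<partial>factorial_moment_measure P Z k)"
proof -
  interpret prob_space P by fact
  have \<sigma>: "sigma_finite_measure P" ..
  from thin obtain I :: "'w \<Rightarrow> nat set" and \<zeta> :: "nat \<Rightarrow> 'w \<Rightarrow> 'a" and U :: "nat \<Rightarrow> 'w \<Rightarrow> real"
    where U: "indep_vars (\<lambda>_. borel) U UNIV"
    and unif: "\<And>n. distr P borel (U n) = uniform_measure lborel {0..1}"
    and D: "(\<lambda>\<omega> n. (n \<in> I \<omega>, \<zeta> n \<omega>)) \<in> measurable P (\<Pi>\<^sub>M n\<in>UNIV. count_space UNIV \<Otimes>\<^sub>M borel)"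
    and indep: "indep_set
          (sets (vimage_algebra (space P) (\<lambda>\<omega> n. U n \<omega>) (\<Pi>\<^sub>M n\<in>UNIV. borel)))
          (sets (vimage_algebra (space P) (\<lambda>\<omega> n. (n \<in> I \<omega>, \<zeta> n \<omega>))
             (\<Pi>\<^sub>M n\<in>UNIV. count_space UNIV \<Otimes>\<^sub>M borel)))"
    and Z: "\<And>\<omega>. \<omega> \<in> space P \<Longrightarrow> Z \<omega> = distr (count_space (I \<omega>)) borel (\<lambda>n. \<zeta> n \<omega>)"
    and M: "\<And>\<omega>. \<omega> \<in> space P \<Longrightarrow>
      M \<omega> = distr (count_space {n \<in> I \<omega>. U n \<omega> < q (\<zeta> n \<omega>)}) borel (\<lambda>n. \<zeta> n \<omega>)"
    unfolding independent_thinning_def by blast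
  note I_m [measurable] = measurable_enumeration_mem[OF D]
  note \<zeta>_m [measurable] = measurable_enumeration_point[OF D]
  have U_m [measurable]: "U n \<in> borel_measurable P" for n
    using U by (auto simp: indep_vars_def)
  define J where "J \<omega> = {n \<in> I \<omega>. U n \<omega> < q (\<zeta> n \<omega>)}" for \<omega>
  have J_m: "Measurable.pred P (\<lambda>\<omega>. n \<in> J \<omega>)" for n
    unfolding J_def mem_Collect_eq by measurable
  have h\<zeta>_m: "(\<lambda>\<omega>. h (\<zeta> n \<omega>)) \<in> borel_measurable P" for n
    by measurable
  have X: "distr (M \<omega>) borel h = distr (count_space (J \<omega>)) borel (\<lambda>n. h (\<zeta> n \<omega>))" if "\<omega> \<in> space P" for \<omega>
    using M[OF that] by (simp add: J_def distr_distr comp_def)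
  let ?C = "count_space (injective_tuples k)"
  let ?F = "\<lambda>z. indicator A (\<lambda>j\<in>{..<k}. h (z j)) :: ennreal"
  have hm: "(\<lambda>z. \<lambda>j\<in>{..<k}. h (z j)) \<in> measurable (\<Pi>\<^sub>M j\<in>{..<k}. borel) (\<Pi>\<^sub>M j\<in>{..<k}. borel)"
    by measurable
  have F [measurable]: "?F \<in> borel_measurable (\<Pi>\<^sub>M j\<in>{..<k}. borel)"
    by (rule measurable_compose[OF hm]) measurable
  have qF: "(\<lambda>z. (\<Prod>j<k. ennreal (q (z j))) * ?F z) \<in> borel_measurable (\<Pi>\<^sub>M j\<in>{..<k}. borel)"
    by measurable
  have sets: "sets (factorial_moment_measure P (\<lambda>\<omega>. distr (M \<omega>) borel h) k) = sets (\<Pi>\<^sub>M j\<in>{..<k}. borel)"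
    by (subst factorial_moment_measure_eq_tuple_measure[OF \<sigma> J_m h\<zeta>_m X]) (simp_all add: tuple_measure_def)
  have "emeasure (factorial_moment_measure P (\<lambda>\<omega>. distr (M \<omega>) borel h) k) A
      = (\<integral>\<^sup>+ \<omega>. factorial_sum k (distr (M \<omega>) borel h) (indicator A) \<partial>P)"
    by (subst nn_integral_factorial_sum[OF \<sigma> J_m h\<zeta>_m X]) (simp_all add: sets)
  also have "\<dots> = (\<integral>\<^sup>+ p. \<integral>\<^sup>+ \<omega>. (\<Prod>j<k. indicator (J \<omega>) (p j)) *
      indicator A (\<lambda>j\<in>{..<k}. h (\<zeta> (p j) \<omega>)) \<partial>P \<partial>?C)"
    by (rule nn_integral_factorial_sum_enumeration(1)[OF \<sigma> J_m h\<zeta>_m X]) simp_all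
  also have "\<dots> = (\<integral>\<^sup>+ p. \<integral>\<^sup>+ \<omega>. (\<Prod>j<k. indicator (I \<omega>) (p j)) *
        ((\<Prod>j<k. ennreal (q ((\<lambda>j\<in>{..<k}. \<zeta> (p j) \<omega>) j))) * ?F (\<lambda>j\<in>{..<k}. \<zeta> (p j) \<omega>)) \<partial>P \<partial>?C)"
  proof (rule nn_integral_cong)
    fix p assume "p \<in> space ?C"
    then have p: "inj_on p {..<k}"
      by (simp add: injective_tuples_def)
    have eq: "(\<lambda>j\<in>{..<k}. h ((\<lambda>j\<in>{..<k}. \<zeta> (p j) \<omega>) j)) = (\<lambda>j\<in>{..<k}. h (\<zeta> (p j) \<omega>))" for \<omega>
      by auto
    show "(\<integral>\<^sup>+ \<omega>. (\<Prod>j<k. indicator (J \<omega>) (p j)) * indicator A (\<lambda>j\<in>{..<k}. h (\<zeta> (p j) \<omega>)) \<partial>P)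
        = (\<integral>\<^sup>+ \<omega>. (\<Prod>j<k. indicator (I \<omega>) (p j)) *
        ((\<Prod>j<k. ennreal (q ((\<lambda>j\<in>{..<k}. \<zeta> (p j) \<omega>) j))) * ?F (\<lambda>j\<in>{..<k}. \<zeta> (p j) \<omega>)) \<partial>P)"
      using nn_integral_thinned_tuple[OF U unif D indep q q01 F p] unfolding eq J_def by simp
  qed
  also have "\<dots> = (\<integral>\<^sup>+ \<omega>. factorial_sum k (Z \<omega>) (\<lambda>z. (\<Prod>j<k. ennreal (q (z j))) * ?F z) \<partial>P)"
    by (rule nn_integral_factorial_sum_enumeration(1)[OF \<sigma> I_m \<zeta>_m Z qF, symmetric])
  also have "\<dots> = (\<integral>\<^sup>+ z. (\<Prod>j<k. ennreal (q (z j))) * ?F z \<partial>factorial_moment_measure P Z k)"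
    by (rule nn_integral_factorial_sum[OF \<sigma> I_m \<zeta>_m Z qF])
  finally show ?thesis .
qed

lemma sets_factorial_moment_measure:
  "sets (factorial_moment_measure P X k) = sets (\<Pi>\<^sub>M j\<in>{..<k}. borel)"
proof -
  have sp: "{..<k} \<rightarrow>\<^sub>E UNIV = space (\<Pi>\<^sub>M j\<in>{..<k}. borel)"
    by (simp add: space_PiM)
  show ?thesis
    unfolding factorial_moment_measure_def sp
    by (simp add: sets.space_closed sets.sigma_sets_eq)
qed

section \<open>Determinantal densities and product measures\<close>

text \<open>Exhibits the determinant as a polynomial in kernel values, so that measurability and
  continuity reduce to single entries.\<close>

lemma kernel_det_leibniz:
  "kernel_det K k z = Re (\<Sum>p | p permutes {0..<k}. signof p * (\<Prod>i = 0..<k. K (z i) (z (p i))))"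
proof -
  have "det (kernel_matrix K k z)
      = (\<Sum>p | p permutes {0..<k}. signof p * (\<Prod>i = 0..<k. kernel_matrix K k z $$ (i, p i)))"
    by (rule det_def') (simp add: kernel_matrix_def)
  also have "\<dots> = (\<Sum>p | p permutes {0..<k}. signof p * (\<Prod>i = 0..<k. K (z i) (z (p i))))"
  proof (intro sum.cong arg_cong2[where f = "(*)"] prod.cong refl)
    fix p i assume "p \<in> {p. p permutes {0..<k}}" "i \<in> {0..<k}"
    then have "i < k" "p i < k"
      using permutes_in_image[of p "{0..<k}" i] by auto
    then show "kernel_matrix K k z $$ (i, p i) = K (z i) (z (p i))"
      by (simp add: kernel_matrix_def)
  qed
  finally show ?thesis
    by (simp add: kernel_det_def)
qed

lemma kernel_det_cong:
  assumes "\<And>j. j < k \<Longrightarrow> z j = z' j"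
  shows "kernel_det K k z = kernel_det K k z'"
proof -
  have "kernel_matrix K k z = kernel_matrix K k z'"
    by (rule eq_matI) (auto simp: kernel_matrix_def assms)
  then show ?thesis
    by (simp add: kernel_det_def)
qed

text \<open>Rows and columns undergo the same permutation, so its sign occurs twice and
  cancels.\<close>

lemma kernel_det_permute:
  assumes "\<sigma> permutes {..<k}"
  shows "kernel_det K k (z \<circ> \<sigma>) = kernel_det K k z"
proof -
  have \<sigma>: "\<sigma> permutes {0..<k}"
    using assms by (simp add: atLeast0LessThan)
  then have lt: "\<sigma> i < k" if "i < k" for i
    using permutes_in_image[OF \<sigma>, of i] that by simp
  define A where "A = kernel_matrix K k z"
  define B where "B = mat k k (\<lambda>(i, j). A $$ (\<sigma> i, j))"
  have A: "A \<in> carrier_mat k k" and B: "B \<in> carrier_mat k k"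
    by (simp_all add: A_def B_def kernel_matrix_def)
  \<comment> \<open>Columns are permuted as rows of the transpose.\<close>
  have "kernel_matrix K k (z \<circ> \<sigma>) = transpose_mat (mat k k (\<lambda>(i, j). transpose_mat B $$ (\<sigma> i, j)))"
    by (rule eq_matI) (auto simp: kernel_matrix_def A_def B_def lt)
  then have "det (kernel_matrix K k (z \<circ> \<sigma>)) = det (mat k k (\<lambda>(i, j). transpose_mat B $$ (\<sigma> i, j)))"
    by (simp add: det_transpose[where n = k])
  also have "\<dots> = signof \<sigma> * det (transpose_mat B)"
    by (rule det_permute_rows[OF _ \<sigma>]) (use B in simp)
  also have "det (transpose_mat B) = signof \<sigma> * det A"
    unfolding det_transpose[OF B] unfolding B_def by (rule det_permute_rows[OF A \<sigma>])
  also have "signof \<sigma> * (signof \<sigma> * det A) = det A"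
    by (simp add: sign_def)
  finally show ?thesis
    by (simp add: kernel_det_def A_def comp_def)
qed

lemma borel_measurable_cnj [measurable]: "cnj \<in> borel_measurable borel"
  by (intro borel_measurable_continuous_onI continuous_intros)

lemma borel_measurable_kernel_det_H:
  "kernel_det kernel_H k \<in> borel_measurable (\<Pi>\<^sub>M j\<in>{..<k}. borel)"
proof -
  have [measurable]: "(\<lambda>z. kernel_H (z i) (z (p i))) \<in> borel_measurable (\<Pi>\<^sub>M j\<in>{..<k}. borel)"
    if "p permutes {0..<k}" "i < k" for p i
  proof -
    have "p i < k"
      using permutes_in_image[OF that(1), of i] that(2) by simp
    then have [measurable]: "(\<lambda>z. z (p i)) \<in> borel_measurable (\<Pi>\<^sub>M j\<in>{..<k}. (borel :: complex measure))"
      by (intro measurable_component_singleton) simp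
    have [measurable]: "(\<lambda>z. z i) \<in> borel_measurable (\<Pi>\<^sub>M j\<in>{..<k}. (borel :: complex measure))"
      using that(2) by (intro measurable_component_singleton) simp
    show ?thesis
      unfolding kernel_H_def by measurable
  qed
  have "(\<lambda>z. Re (\<Sum>p | p permutes {0..<k}. signof p * (\<Prod>i = 0..<k. kernel_H (z i) (z (p i)))))
      \<in> borel_measurable (\<Pi>\<^sub>M j\<in>{..<k}. borel)"
    by (intro borel_measurable_sum borel_measurable_times borel_measurable_prod borel_measurable_const
        measurable_compose[OF _ borel_measurable_Re]) auto
  then show ?thesis
    by (simp add: kernel_det_leibniz[abs_def])
qed

text \<open>The heights stay fixed and positive: the imaginary part of the difference in each
  denominator is \<open>y i + y j\<close>, so no denominator vanishes.\<close>

lemma tendsto_kernel_det_H: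
  assumes x: "\<And>j. j < k \<Longrightarrow> ((\<lambda>n. x n j) \<longlongrightarrow> x' j) F" and y: "\<And>j. j < k \<Longrightarrow> 0 < y j"
  shows "((\<lambda>n. kernel_det kernel_H k (\<lambda>j. Complex (x n j) (y j)))
    \<longlongrightarrow> kernel_det kernel_H k (\<lambda>j. Complex (x' j) (y j))) F"
proof -
  have "((\<lambda>n. kernel_H (Complex (x n i) (y i)) (Complex (x n j) (y j)))
      \<longlongrightarrow> kernel_H (Complex (x' i) (y i)) (Complex (x' j) (y j))) F" if "i < k" "j < k" for i j
  proof -
    have "Im (Complex (x' i) (y i) - cnj (Complex (x' j) (y j))) > 0"
      using y[OF that(1)] y[OF that(2)] by simp
    then have "Complex (x' i) (y i) - cnj (Complex (x' j) (y j)) \<noteq> 0"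
      by (metis less_irrefl zero_complex.sel(2))
    then show ?thesis
      unfolding kernel_H_def
      by (intro tendsto_intros x that) auto
  qed
  then show ?thesis
    unfolding kernel_det_leibniz
    by (intro tendsto_intros)
      (auto intro: permutes_in_image[THEN iffD2, of _ "{0..<_}", simplified])
qed

section \<open>Products of Lebesgue measures and of densities\<close>

lemma product_sigma_finite_lborel: "product_sigma_finite (\<lambda>_. lborel)"
  by (simp add: product_sigma_finite_def lborel.sigma_finite_measure_axioms)

text \<open>Boxes determine a finite product measure, and on a box both the density and the
  indicator split into coordinate factors.\<close>

lemma PiM_density:
  assumes "finite I" "sigma_finite_measure M" "sigma_finite_measure (density M f)"
    and f [measurable]: "f \<in> borel_measurable M"
  shows "(\<Pi>\<^sub>M i\<in>I. density M f) = density (\<Pi>\<^sub>M i\<in>I. M) (\<lambda>x. \<Prod>i\<in>I. f (x i))"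
proof -
  interpret D: product_sigma_finite "\<lambda>_. density M f"
    using assms by (simp add: product_sigma_finite_def)
  interpret M: product_sigma_finite "\<lambda>_. M"
    using assms by (simp add: product_sigma_finite_def)
  have "density (\<Pi>\<^sub>M i\<in>I. M) (\<lambda>x. \<Prod>i\<in>I. f (x i)) = (\<Pi>\<^sub>M i\<in>I. density M f)"
  proof (rule D.PiM_eqI)
    show "sets (density (\<Pi>\<^sub>M i\<in>I. M) (\<lambda>x. \<Prod>i\<in>I. f (x i))) = sets (\<Pi>\<^sub>M i\<in>I. density M f)"
      by (simp cong: sets_PiM_cong)
    fix A assume "\<And>i. i \<in> I \<Longrightarrow> A i \<in> sets (density M f)"
    then have A [measurable]: "\<And>i. i \<in> I \<Longrightarrow> A i \<in> sets M"
      by simp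
    have "emeasure (density (\<Pi>\<^sub>M i\<in>I. M) (\<lambda>x. \<Prod>i\<in>I. f (x i))) (Pi\<^sub>E I A)
        = (\<integral>\<^sup>+ x. (\<Prod>i\<in>I. f (x i)) * indicator (Pi\<^sub>E I A) x \<partial>(\<Pi>\<^sub>M i\<in>I. M))"
      using assms(1) A by (intro emeasure_density) auto
    also have "\<dots> = (\<integral>\<^sup>+ x. (\<Prod>i\<in>I. f (x i) * indicator (A i) (x i)) \<partial>(\<Pi>\<^sub>M i\<in>I. M))"
    proof (rule nn_integral_cong)
      fix x assume "x \<in> space (\<Pi>\<^sub>M i\<in>I. M)"
      then have "indicator (Pi\<^sub>E I A) x = (\<Prod>i\<in>I. indicator (A i) (x i) :: ennreal)"
        using assms(1) by (auto simp: indicator_def space_PiM PiE_iff intro!: prod.neutral[symmetric])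
      then show "(\<Prod>i\<in>I. f (x i)) * indicator (Pi\<^sub>E I A) x = (\<Prod>i\<in>I. f (x i) * indicator (A i) (x i))"
        by (simp add: prod.distrib)
    qed
    also have "\<dots> = (\<Prod>i\<in>I. \<integral>\<^sup>+ t. f t * indicator (A i) t \<partial>M)"
      using assms(1) A by (intro M.product_nn_integral_prod) auto
    also have "\<dots> = (\<Prod>i\<in>I. emeasure (density M f) (A i))"
      using A by (intro prod.cong refl emeasure_density[symmetric]) auto
    finally show "emeasure (density (\<Pi>\<^sub>M i\<in>I. M) (\<lambda>x. \<Prod>i\<in>I. f (x i))) (Pi\<^sub>E I A)
        = (\<Prod>i\<in>I. emeasure (density M f) (A i))" .
  qed fact
  then show ?thesis
    by simp
qed

lemma borel_measurable_Complex_pair [measurable]: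
  "(\<lambda>(x, y). Complex x y) \<in> borel_measurable (borel \<Otimes>\<^sub>M borel)"
  unfolding Complex_eq by measurable

text \<open>Lebesgue measure is determined by boxes, and with the basis \<open>{1, \<i>}\<close> a
  box is a product of intervals for the real and imaginary parts.\<close>

lemma lborel_complex: "(lborel :: complex measure) = distr (lborel \<Otimes>\<^sub>M lborel) borel (\<lambda>(x, y). Complex x y)"
proof (rule lborel_eqI)
  fix l u :: complex
  assume "\<And>b. b \<in> Basis \<Longrightarrow> l \<bullet> b \<le> u \<bullet> b"
  from this[of 1] this[of \<i>] have le: "Re l \<le> Re u" "Im l \<le> Im u"
    by (auto simp: Basis_complex_def)
  have "(\<lambda>(x, y). Complex x y) -` box l u \<inter> space (lborel \<Otimes>\<^sub>M lborel) = {Re l<..<Re u} \<times> {Im l<..<Im u}"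
    by (auto simp: box_def Basis_complex_def space_pair_measure)
  then have "emeasure (distr (lborel \<Otimes>\<^sub>M lborel) borel (\<lambda>(x, y). Complex x y)) (box l u)
      = emeasure (lborel \<Otimes>\<^sub>M lborel) ({Re l<..<Re u} \<times> {Im l<..<Im u})"
    by (subst emeasure_distr) auto
  also have "\<dots> = ennreal (\<Prod>b\<in>Basis. (u - l) \<bullet> b)"
    using le by (subst lborel.emeasure_pair_measure_Times) (auto simp: Basis_complex_def ennreal_mult)
  finally show "emeasure (distr (lborel \<Otimes>\<^sub>M lborel) borel (\<lambda>(x, y). Complex x y)) (box l u)
      = ennreal (\<Prod>b\<in>Basis. (u - l) \<bullet> b)" .
qed simp

lemma measurable_restrict_Complex:
  "(\<lambda>(x, y). \<lambda>i\<in>I. Complex (x i) (y i)) \<in> measurable ((\<Pi>\<^sub>M i\<in>I. borel) \<Otimes>\<^sub>M (\<Pi>\<^sub>M i\<in>I. borel)) (\<Pi>\<^sub>M i\<in>I. borel)"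
proof -
  have "(\<lambda>z. \<lambda>i\<in>I. case (fst z i, snd z i) of (x, y) \<Rightarrow> Complex x y)
      \<in> measurable ((\<Pi>\<^sub>M i\<in>I. borel) \<Otimes>\<^sub>M (\<Pi>\<^sub>M i\<in>I. borel)) (\<Pi>\<^sub>M i\<in>I. borel)"
    by (intro measurable_restrict measurable_compose[OF _ borel_measurable_Complex_pair]) measurable
  then show ?thesis
    by (simp add: case_prod_beta)
qed

lemma sets_PiM_lborel: "sets (\<Pi>\<^sub>M i\<in>I. lborel) = sets (\<Pi>\<^sub>M i\<in>I. borel)"
  by (rule sets_PiM_cong) simp_all

text \<open>The projection integrates out all heights at once, so the coordinates must be regrouped
  from a tuple of pairs into a pair of tuples.\<close>

lemma PiM_lborel_complex:
  assumes "finite I"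
  shows "(\<Pi>\<^sub>M i\<in>I. lborel) = distr ((\<Pi>\<^sub>M i\<in>I. lborel) \<Otimes>\<^sub>M (\<Pi>\<^sub>M i\<in>I. lborel)) (\<Pi>\<^sub>M i\<in>I. borel)
    (\<lambda>(x, y). \<lambda>i\<in>I. Complex (x i) (y i))"
proof -
  interpret C: product_sigma_finite "\<lambda>_. lborel :: complex measure" by (rule product_sigma_finite_lborel)
  interpret R: product_sigma_finite "\<lambda>_. lborel :: real measure" by (rule product_sigma_finite_lborel)
  interpret RI: sigma_finite_measure "\<Pi>\<^sub>M i\<in>I. lborel :: real measure" by (rule R.sigma_finite[OF assms])
  let ?R = "\<Pi>\<^sub>M i\<in>I. lborel :: real measure"
  let ?h = "\<lambda>(x, y). \<lambda>i\<in>I. Complex (x i) (y i)"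
  have sets_R: "sets (?R \<Otimes>\<^sub>M ?R) = sets ((\<Pi>\<^sub>M i\<in>I. borel) \<Otimes>\<^sub>M (\<Pi>\<^sub>M i\<in>I. borel))"
    by (intro sets_pair_measure_cong sets_PiM_lborel)
  have h: "?h \<in> measurable (?R \<Otimes>\<^sub>M ?R) (\<Pi>\<^sub>M i\<in>I. borel)"
    using measurable_restrict_Complex[of I] by (simp cong: measurable_cong_sets add: sets_R)
  have "distr (?R \<Otimes>\<^sub>M ?R) (\<Pi>\<^sub>M i\<in>I. borel) ?h = (\<Pi>\<^sub>M i\<in>I. lborel)"
  proof (rule C.PiM_eqI[OF assms])
    show "sets (distr (?R \<Otimes>\<^sub>M ?R) (\<Pi>\<^sub>M i\<in>I. borel) ?h) = sets (\<Pi>\<^sub>M i\<in>I. lborel)"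
      by (simp add: sets_PiM_lborel)
    fix A :: "'a \<Rightarrow> complex set" assume "\<And>i. i \<in> I \<Longrightarrow> A i \<in> sets lborel"
    then have A: "\<And>i. i \<in> I \<Longrightarrow> A i \<in> sets borel"
      by simp
    have PA: "Pi\<^sub>E I A \<in> sets (\<Pi>\<^sub>M i\<in>I. borel)"
      using assms A by (intro sets_PiM_I_finite) auto
    define f where "f i x y = (indicator (A i) (Complex x y) :: ennreal)" for i x y
    have f: "(\<lambda>(x, y). f i x y) \<in> borel_measurable (borel \<Otimes>\<^sub>M borel)" if "i \<in> I" for i
      using measurable_compose[OF borel_measurable_Complex_pair borel_measurable_indicator[OF A[OF that]]]
      unfolding f_def by (simp add: case_prod_unfold)
    have f2: "f i x \<in> borel_measurable borel" if "i \<in> I" for i x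
      using measurable_compose[OF measurable_Pair1' f[OF that], of x] by simp
    have f1: "(\<lambda>x. \<integral>\<^sup>+ y. f i x y \<partial>lborel) \<in> borel_measurable borel" if "i \<in> I" for i
      using f[OF that] by (intro lborel.borel_measurable_nn_integral) simp
    have "emeasure (distr (?R \<Otimes>\<^sub>M ?R) (\<Pi>\<^sub>M i\<in>I. borel) ?h) (Pi\<^sub>E I A)
        = (\<integral>\<^sup>+ z. indicator (Pi\<^sub>E I A) z \<partial>distr (?R \<Otimes>\<^sub>M ?R) (\<Pi>\<^sub>M i\<in>I. borel) ?h)"
      using PA by simp
    also have "\<dots> = (\<integral>\<^sup>+ z. indicator (Pi\<^sub>E I A) (?h z) \<partial>(?R \<Otimes>\<^sub>M ?R))"
      using PA by (intro nn_integral_distr h) simp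
    also have "\<dots> = (\<integral>\<^sup>+ x. \<integral>\<^sup>+ y. indicator (Pi\<^sub>E I A) (?h (x, y)) \<partial>?R \<partial>?R)"
      using measurable_compose[OF h borel_measurable_indicator[OF PA]]
      by (intro RI.nn_integral_fst[symmetric]) simp
    \<comment> \<open>The indicator of a box splits over coordinates, so the inner integral
      factorises, and then the outer one.\<close>
    also have "\<dots> = (\<integral>\<^sup>+ x. \<integral>\<^sup>+ y. (\<Prod>i\<in>I. f i (x i) (y i)) \<partial>?R \<partial>?R)"
      using assms by (intro nn_integral_cong) (auto simp: f_def indicator_def PiE_iff intro!: prod.neutral[symmetric])
    also have "\<dots> = (\<integral>\<^sup>+ x. (\<Prod>i\<in>I. \<integral>\<^sup>+ y. f i (x i) y \<partial>lborel) \<partial>?R)"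
      using assms f2 by (intro nn_integral_cong R.product_nn_integral_prod) auto
    also have "\<dots> = (\<Prod>i\<in>I. \<integral>\<^sup>+ x. \<integral>\<^sup>+ y. f i x y \<partial>lborel \<partial>lborel)"
      using assms f1 by (intro R.product_nn_integral_prod) auto
    also have "\<dots> = (\<Prod>i\<in>I. emeasure lborel (A i))"
    proof (rule prod.cong)
      fix i assume i: "i \<in> I"
      have "(\<integral>\<^sup>+ x. \<integral>\<^sup>+ y. f i x y \<partial>lborel \<partial>lborel) = (\<integral>\<^sup>+ z. (\<lambda>(x, y). f i x y) z \<partial>(lborel \<Otimes>\<^sub>M lborel))"
        using lborel.nn_integral_fst[of "\<lambda>(x, y). f i x y" lborel] f[OF i] by simp
      also have "\<dots> = (\<integral>\<^sup>+ z. indicator (A i) z \<partial>distr (lborel \<Otimes>\<^sub>M lborel) borel (\<lambda>(x, y). Complex x y))"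
        using A[OF i] by (subst nn_integral_distr) (auto simp: f_def case_prod_unfold)
      also have "\<dots> = emeasure lborel (A i)"
        using A[OF i] by (simp add: lborel_complex[symmetric])
      finally show "(\<integral>\<^sup>+ x. \<integral>\<^sup>+ y. f i x y \<partial>lborel \<partial>lborel) = emeasure lborel (A i)" .
    qed simp
    finally show "emeasure (distr (?R \<Otimes>\<^sub>M ?R) (\<Pi>\<^sub>M i\<in>I. borel) ?h) (Pi\<^sub>E I A) = (\<Prod>i\<in>I. emeasure lborel (A i))" .
  qed
  then show ?thesis
    by simp
qed

lemma nn_integral_PiM_lborel_complex:
  assumes I: "finite I" and F: "F \<in> borel_measurable (\<Pi>\<^sub>M i\<in>I. borel)"
  shows "(\<integral>\<^sup>+ z. F z \<partial>(\<Pi>\<^sub>M i\<in>I. (lborel :: complex measure))) =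
    (\<integral>\<^sup>+ x. \<integral>\<^sup>+ y. F (\<lambda>i\<in>I. Complex (x i) (y i)) \<partial>(\<Pi>\<^sub>M i\<in>I. lborel) \<partial>(\<Pi>\<^sub>M i\<in>I. lborel))"
proof -
  interpret R: product_sigma_finite "\<lambda>_. lborel :: real measure" by (rule product_sigma_finite_lborel)
  let ?R = "\<Pi>\<^sub>M i\<in>I. lborel :: real measure"
  interpret RI: sigma_finite_measure ?R by (rule R.sigma_finite[OF I])
  let ?h = "\<lambda>(x, y). \<lambda>i\<in>I. Complex (x i) (y i)"
  have sets_R: "sets (?R \<Otimes>\<^sub>M ?R) = sets ((\<Pi>\<^sub>M i\<in>I. borel) \<Otimes>\<^sub>M (\<Pi>\<^sub>M i\<in>I. borel))"
    by (intro sets_pair_measure_cong sets_PiM_lborel)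
  have h: "?h \<in> measurable (?R \<Otimes>\<^sub>M ?R) (\<Pi>\<^sub>M i\<in>I. borel)"
    using measurable_restrict_Complex[of I] by (simp cong: measurable_cong_sets add: sets_R)
  have "(\<integral>\<^sup>+ z. F z \<partial>(\<Pi>\<^sub>M i\<in>I. lborel)) = (\<integral>\<^sup>+ z. F (?h z) \<partial>(?R \<Otimes>\<^sub>M ?R))"
    by (subst PiM_lborel_complex[OF I]) (simp add: nn_integral_distr h F)
  also have "\<dots> = (\<integral>\<^sup>+ x. \<integral>\<^sup>+ y. F (?h (x, y)) \<partial>?R \<partial>?R)"
    using measurable_compose[OF h F] by (intro RI.nn_integral_fst[symmetric]) simp
  finally show ?thesis
    by simp
qed

text \<open>The preimage of a box is the box with its sides rearranged by the inverse permutation,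
  and the product of the side lengths is unchanged. It supplies the change of variables in
  \<open>rho_permute\<close>.\<close>

lemma distr_PiM_lborel_permute:
  assumes \<sigma>: "\<sigma> permutes I" and I: "finite I"
  shows "distr (\<Pi>\<^sub>M i\<in>I. lborel) (\<Pi>\<^sub>M i\<in>I. lborel) (\<lambda>y. \<lambda>i\<in>I. y (\<sigma> i)) = (\<Pi>\<^sub>M i\<in>I. (lborel :: real measure))"
proof -
  interpret R: product_sigma_finite "\<lambda>_. lborel :: real measure" by (rule product_sigma_finite_lborel)
  let ?R = "\<Pi>\<^sub>M i\<in>I. lborel :: real measure"
  note \<sigma>_in = permutes_in_image[OF \<sigma>]
  have m: "(\<lambda>y. \<lambda>i\<in>I. y (\<sigma> i)) \<in> measurable ?R ?R"
    using \<sigma>_in by (intro measurable_restrict measurable_component_singleton) auto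
  show ?thesis
  proof (rule R.PiM_eqI[OF I])
    fix A :: "'a \<Rightarrow> real set" assume A: "\<And>i. i \<in> I \<Longrightarrow> A i \<in> sets lborel"
    have eq: "(\<lambda>y. \<lambda>i\<in>I. y (\<sigma> i)) -` Pi\<^sub>E I A \<inter> space ?R = Pi\<^sub>E I (\<lambda>i. A (inv_into UNIV \<sigma> i))"
    proof (intro equalityI subsetI)
      fix y assume "y \<in> (\<lambda>y. \<lambda>i\<in>I. y (\<sigma> i)) -` Pi\<^sub>E I A \<inter> space ?R"
      then have y: "y \<in> extensional I" "\<And>i. i \<in> I \<Longrightarrow> y (\<sigma> i) \<in> A i"
        by (auto simp: space_PiM PiE_iff)
      have "y i \<in> A (inv_into UNIV \<sigma> i)" if "i \<in> I" for i
        using y(2)[of "inv_into UNIV \<sigma> i"] that permutes_in_image[OF permutes_inv[OF \<sigma>]] permutes_inverses(1)[OF \<sigma>] by simp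
      then show "y \<in> Pi\<^sub>E I (\<lambda>i. A (inv_into UNIV \<sigma> i))"
        using y(1) by (auto simp: PiE_iff)
    next
      fix y assume "y \<in> Pi\<^sub>E I (\<lambda>i. A (inv_into UNIV \<sigma> i))"
      then show "y \<in> (\<lambda>y. \<lambda>i\<in>I. y (\<sigma> i)) -` Pi\<^sub>E I A \<inter> space ?R"
        using \<sigma>_in permutes_inverses(2)[OF \<sigma>] by (fastforce simp: space_PiM PiE_iff)
    qed
    have "emeasure (distr ?R ?R (\<lambda>y. \<lambda>i\<in>I. y (\<sigma> i))) (Pi\<^sub>E I A) = emeasure ?R (Pi\<^sub>E I (\<lambda>i. A (inv_into UNIV \<sigma> i)))"
      using I A by (subst emeasure_distr[OF m]) (auto simp: eq intro!: sets_PiM_I_finite)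
    also have "\<dots> = (\<Prod>i\<in>I. emeasure lborel (A (inv_into UNIV \<sigma> i)))"
      using I A permutes_in_image[OF permutes_inv[OF \<sigma>]] by (intro R.emeasure_PiM) auto
    also have "\<dots> = (\<Prod>i\<in>I. emeasure lborel (A i))"
      using prod.permute[OF permutes_inv[OF \<sigma>], of "\<lambda>i. emeasure lborel (A i)"] by (simp add: comp_def)
    finally show "emeasure (distr ?R ?R (\<lambda>y. \<lambda>i\<in>I. y (\<sigma> i))) (Pi\<^sub>E I A) = (\<Prod>i\<in>I. emeasure lborel (A i))" .
  qed simp
qed

section \<open>The correlation functions of the projected strip\<close>

text \<open>\<open>w\<close> times the one-point intensity of the half-plane process at height
  \<open>y\<close>: a single factor of the Hadamard majorant.\<close>

definition weight_density :: "(real \<Rightarrow> real) \<Rightarrow> real \<Rightarrow> real" where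
  "weight_density w y = indicator {0<..} y * (w y / (4 * pi * y\<^sup>2))"

lemma weightsD:
  assumes "w \<in> weights \<alpha> \<beta>"
  shows "w \<in> borel_measurable borel" "0 \<le> w y" "w y \<le> 1" "y \<notin> {\<alpha>..\<beta>} \<Longrightarrow> w y = 0"
  using assms by (auto simp: weights_def image_subset_iff)

lemma weight_density_nonneg:
  assumes "w \<in> weights \<alpha> \<beta>"
  shows "0 \<le> weight_density w y"
  using weightsD(2)[OF assms] by (simp add: weight_density_def)

text \<open>The weight lives on a bounded interval whose left end \<alpha> is positive, and there
  the density is at most \<open>1 / (4 * pi * \<alpha>\<^sup>2)\<close>.\<close>

lemma
  assumes \<alpha>: "0 < \<alpha>" and w: "w \<in> weights \<alpha> \<beta>"
  shows integrable_weight_density: "integrable lborel (weight_density w)"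
    and integral_weight_density: "(\<integral>y. weight_density w y \<partial>lborel) = intensity w"
proof -
  note [measurable] = weightsD(1)[OF w]
  show "integrable lborel (weight_density w)"
  proof (rule Bochner_Integration.integrable_bound)
    show "integrable lborel (\<lambda>y. indicator {\<alpha>..\<beta>} y * (1 / (4 * pi * \<alpha>\<^sup>2)) :: real)"
      by (intro integrable_mult_left integrable_real_indicator) (auto simp: emeasure_lborel_Icc_eq)
    show "weight_density w \<in> borel_measurable lborel"
      unfolding weight_density_def by measurable
    have "norm (weight_density w y) \<le> norm (indicator {\<alpha>..\<beta>} y * (1 / (4 * pi * \<alpha>\<^sup>2)))" for y
    proof (cases "y \<in> {\<alpha>..\<beta>}")
      case True
      then have "\<alpha>\<^sup>2 \<le> y\<^sup>2"
        using \<alpha> by (intro power_mono) auto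
      then have "w y / (4 * pi * y\<^sup>2) \<le> 1 / (4 * pi * \<alpha>\<^sup>2)"
        using \<alpha> weightsD(2,3)[OF w, of y] by (intro frac_le mult_left_mono) auto
      then show ?thesis
        using True weightsD(2)[OF w, of y] by (simp add: weight_density_def indicator_def)
    next
      case False
      then show ?thesis
        using weightsD(4)[OF w] by (simp add: weight_density_def)
    qed
    then show "AE y in lborel. norm (weight_density w y) \<le> norm (indicator {\<alpha>..\<beta>} y * (1 / (4 * pi * \<alpha>\<^sup>2)))"
      by simp
  qed
  have "(\<integral>y. weight_density w y \<partial>lborel) = (\<integral>y. 1 / (4 * pi) * (indicator {0<..} y *\<^sub>R (w y / y\<^sup>2)) \<partial>lborel)"
    by (intro Bochner_Integration.integral_cong) (simp_all add: weight_density_def)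
  then show "(\<integral>y. weight_density w y \<partial>lborel) = intensity w"
    by (simp only: integral_mult_right_zero intensity_def set_lebesgue_integral_def)
qed

text \<open>The domain of integration is absorbed into the function, so that its bounds hold at
  every \<open>y\<close>; away from the positive orthant the determinant itself may fail to be
  nonnegative.\<close>

definition strip_integrand :: "(real \<Rightarrow> real) \<Rightarrow> nat \<Rightarrow> (nat \<Rightarrow> real) \<Rightarrow> (nat \<Rightarrow> real) \<Rightarrow> real" where
  "strip_integrand w k x y = indicator ({..<k} \<rightarrow>\<^sub>E {0<..}) y *\<^sub>R rho_integrand w k x y"

lemma rho_eq: "rho w k x = (\<integral>y. strip_integrand w k x y \<partial>(\<Pi>\<^sub>M j\<in>{..<k}. lborel))"
  by (simp add: rho_def set_lebesgue_integral_def strip_integrand_def)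

lemma strip_integrand_bounds:
  assumes w: "w \<in> weights \<alpha> \<beta>"
  shows "0 \<le> strip_integrand w k x y" "strip_integrand w k x y \<le> (\<Prod>j<k. weight_density w (y j))"
proof -
  have "0 \<le> strip_integrand w k x y \<and> strip_integrand w k x y \<le> (\<Prod>j<k. weight_density w (y j))"
  proof (cases "y \<in> {..<k} \<rightarrow>\<^sub>E {0<..}")
    case True
    then have y: "0 < y j" if "j < k" for j
      using that by (auto simp: PiE_iff)
    have W: "0 \<le> (\<Prod>j<k. w (y j))"
      by (intro prod_nonneg) (simp add: weightsD(2)[OF w])
    let ?K = "kernel_det kernel_H k (\<lambda>j. Complex (x j) (y j))"
    have K: "0 \<le> ?K" "?K \<le> (\<Prod>j<k. 1 / (4 * pi * (y j)\<^sup>2))"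
      using kernel_det_H_bounds[of k "\<lambda>j. Complex (x j) (y j)"] y by auto
    have "(\<Prod>j<k. weight_density w (y j)) = (\<Prod>j<k. w (y j) * (1 / (4 * pi * (y j)\<^sup>2)))"
      by (intro prod.cong) (auto simp: weight_density_def y)
    then have "(\<Prod>j<k. weight_density w (y j)) = (\<Prod>j<k. w (y j)) * (\<Prod>j<k. 1 / (4 * pi * (y j)\<^sup>2))"
      by (simp only: prod.distrib)
    then show ?thesis
      using True W K by (simp add: strip_integrand_def rho_integrand_def mult_left_mono)
  next
    case False
    then show ?thesis
      by (auto simp: strip_integrand_def intro!: prod_nonneg weight_density_nonneg[OF w])
  qed
  then show "0 \<le> strip_integrand w k x y" "strip_integrand w k x y \<le> (\<Prod>j<k. weight_density w (y j))"
    by auto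
qed

section \<open>Measurability and integrability of the integrand\<close>

lemma borel_measurable_rho_integrand:
  assumes [measurable]: "w \<in> borel_measurable borel"
  shows "(\<lambda>(x, y). rho_integrand w k x y)
    \<in> borel_measurable ((\<Pi>\<^sub>M j\<in>{..<k}. borel) \<Otimes>\<^sub>M (\<Pi>\<^sub>M j\<in>{..<k}. borel))"
proof -
  have "(\<lambda>z. kernel_det kernel_H k ((\<lambda>(x, y). \<lambda>j\<in>{..<k}. Complex (x j) (y j)) z))
      \<in> borel_measurable ((\<Pi>\<^sub>M j\<in>{..<k}. borel) \<Otimes>\<^sub>M (\<Pi>\<^sub>M j\<in>{..<k}. borel))"
    by (rule measurable_compose[OF measurable_restrict_Complex borel_measurable_kernel_det_H])
  also have "(\<lambda>z. kernel_det kernel_H k ((\<lambda>(x, y). \<lambda>j\<in>{..<k}. Complex (x j) (y j)) z))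
      = (\<lambda>z. kernel_det kernel_H k (\<lambda>j. Complex (fst z j) (snd z j)))"
    by (auto simp: fun_eq_iff intro!: kernel_det_cong)
  finally have [measurable]: "(\<lambda>z. kernel_det kernel_H k (\<lambda>j. Complex (fst z j) (snd z j)))
      \<in> borel_measurable ((\<Pi>\<^sub>M j\<in>{..<k}. borel) \<Otimes>\<^sub>M (\<Pi>\<^sub>M j\<in>{..<k}. borel))" .
  show ?thesis
    unfolding rho_integrand_def case_prod_unfold by measurable
qed

lemma sets_positive_orthant: "({..<k} \<rightarrow>\<^sub>E {0<..}) \<in> sets (\<Pi>\<^sub>M j\<in>{..<k::nat}. (borel :: real measure))"
  by (intro sets_PiM_I_finite) auto

lemma borel_measurable_strip_integrand:
  assumes w: "w \<in> borel_measurable borel"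
  shows "(\<lambda>(x, y). strip_integrand w k x y)
    \<in> borel_measurable ((\<Pi>\<^sub>M j\<in>{..<k}. borel) \<Otimes>\<^sub>M (\<Pi>\<^sub>M j\<in>{..<k}. borel))"
proof -
  have [measurable]: "(\<lambda>z. indicator ({..<k} \<rightarrow>\<^sub>E {0<..}) (snd z) :: real)
      \<in> borel_measurable ((\<Pi>\<^sub>M j\<in>{..<k}. borel :: real measure) \<Otimes>\<^sub>M (\<Pi>\<^sub>M j\<in>{..<k}. borel :: real measure))"
    using sets_positive_orthant by measurable
  have [measurable]: "(\<lambda>z. rho_integrand w k (fst z) (snd z))
      \<in> borel_measurable ((\<Pi>\<^sub>M j\<in>{..<k}. borel) \<Otimes>\<^sub>M (\<Pi>\<^sub>M j\<in>{..<k}. borel))"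
    using borel_measurable_rho_integrand[OF w] by (simp add: case_prod_unfold)
  show ?thesis
    unfolding strip_integrand_def case_prod_unfold by measurable
qed

lemma rho_integrand_cong:
  assumes "\<And>j. j < k \<Longrightarrow> x j = x' j" "\<And>j. j < k \<Longrightarrow> y j = y' j"
  shows "rho_integrand w k x y = rho_integrand w k x' y'"
  unfolding rho_integrand_def using assms by (auto intro!: arg_cong2[where f = "(*)"] kernel_det_cong)

lemma strip_integrand_cong:
  assumes "\<And>j. j < k \<Longrightarrow> x j = x' j"
  shows "strip_integrand w k x = strip_integrand w k x'"
proof
  show "strip_integrand w k x y = strip_integrand w k x' y" for y
    unfolding strip_integrand_def using rho_integrand_cong[of k x x' y y w] assms by simp
qed

lemma rho_cong:
  assumes "\<And>j. j < k \<Longrightarrow> x j = x' j"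
  shows "rho w k x = rho w k x'"
  by (simp only: rho_eq strip_integrand_cong[of k x x' w, OF assms])

lemma borel_measurable_strip_integrand':
  assumes w: "w \<in> borel_measurable borel"
  shows "strip_integrand w k x \<in> borel_measurable (\<Pi>\<^sub>M j\<in>{..<k}. borel)"
proof -
  \<comment> \<open>A section must be taken at a point of the product space, which is extensional,
    whereas \<open>x\<close> is arbitrary; restricting it leaves the integrand unchanged.\<close>
  have "(\<lambda>y. (\<lambda>(x, y). strip_integrand w k x y) (restrict x {..<k}, y)) \<in> borel_measurable (\<Pi>\<^sub>M j\<in>{..<k}. borel)"
    by (rule measurable_compose[OF measurable_Pair1' borel_measurable_strip_integrand[OF w]])
      (simp add: space_PiM)
  then show ?thesis
    using strip_integrand_cong[of k "restrict x {..<k}" x w] by simp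
qed

lemma
  assumes \<alpha>: "0 < \<alpha>" and w: "w \<in> weights \<alpha> \<beta>"
  shows integrable_prod_weight_density:
      "integrable (\<Pi>\<^sub>M j\<in>{..<k}. lborel) (\<lambda>y. \<Prod>j<k. weight_density w (y j))"
    and integral_prod_weight_density:
      "(\<integral>y. (\<Prod>j<k. weight_density w (y j)) \<partial>(\<Pi>\<^sub>M j\<in>{..<k::nat}. lborel)) = intensity w ^ k"
    and integrable_strip_integrand: "integrable (\<Pi>\<^sub>M j\<in>{..<k}. lborel) (strip_integrand w k x)"
proof -
  interpret R: product_sigma_finite "\<lambda>_. lborel :: real measure" by (rule product_sigma_finite_lborel)
  show 1: "integrable (\<Pi>\<^sub>M j\<in>{..<k}. lborel) (\<lambda>y. \<Prod>j<k. weight_density w (y j))"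
    by (intro R.product_integrable_prod integrable_weight_density[OF \<alpha> w]) simp
  have "(\<integral>y. (\<Prod>j<k. weight_density w (y j)) \<partial>(\<Pi>\<^sub>M j\<in>{..<k}. lborel))
      = (\<Prod>j<k. \<integral>y. weight_density w y \<partial>lborel)"
    by (intro R.product_integral_prod integrable_weight_density[OF \<alpha> w]) simp
  then show "(\<integral>y. (\<Prod>j<k. weight_density w (y j)) \<partial>(\<Pi>\<^sub>M j\<in>{..<k::nat}. lborel)) = intensity w ^ k"
    by (simp add: integral_weight_density[OF \<alpha> w])
  show "integrable (\<Pi>\<^sub>M j\<in>{..<k}. lborel) (strip_integrand w k x)"
  proof (rule Bochner_Integration.integrable_bound[OF 1])
    show "strip_integrand w k x \<in> borel_measurable (\<Pi>\<^sub>M j\<in>{..<k}. lborel)"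
      using borel_measurable_strip_integrand'[OF weightsD(1)[OF w]]
      by (simp add: measurable_cong_sets[OF sets_PiM_lborel refl])
    have "norm (strip_integrand w k x y) \<le> norm (\<Prod>j<k. weight_density w (y j))" for y
      using strip_integrand_bounds[OF w, of k x y] by simp
    then show "AE y in (\<Pi>\<^sub>M j\<in>{..<k}. lborel). norm (strip_integrand w k x y) \<le> norm (\<Prod>j<k. weight_density w (y j))"
      by simp
  qed
qed

section \<open>Bounds, continuity and symmetries of \<open>rho\<close>\<close>

lemma rho_bounds:
  assumes \<alpha>: "0 < \<alpha>" and w: "w \<in> weights \<alpha> \<beta>"
  shows "0 \<le> rho w k x" "rho w k x \<le> intensity w ^ k"
proof -
  show "0 \<le> rho w k x"
    unfolding rho_eq by (intro Bochner_Integration.integral_nonneg strip_integrand_bounds(1)[OF w])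
  show "rho w k x \<le> intensity w ^ k"
    unfolding rho_eq integral_prod_weight_density[OF \<alpha> w, symmetric]
    by (intro integral_mono integrable_strip_integrand[OF \<alpha> w] integrable_prod_weight_density[OF \<alpha> w]
        strip_integrand_bounds(2)[OF w])
qed

lemma tendsto_rho:
  assumes \<alpha>: "0 < \<alpha>" and w: "w \<in> weights \<alpha> \<beta>"
    and x: "\<And>j. j < k \<Longrightarrow> (\<lambda>n. x n j) \<longlonglongrightarrow> x' j"
  shows "(\<lambda>n. rho w k (x n)) \<longlonglongrightarrow> rho w k x'"
  unfolding rho_eq
proof (rule integral_dominated_convergence[OF _ _ integrable_prod_weight_density[OF \<alpha> w]])
  show "strip_integrand w k x' \<in> borel_measurable (\<Pi>\<^sub>M j\<in>{..<k}. lborel)"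
    "strip_integrand w k (x n) \<in> borel_measurable (\<Pi>\<^sub>M j\<in>{..<k}. lborel)" for n
    by (intro borel_measurable_integrable integrable_strip_integrand[OF \<alpha> w])+
  have "norm (strip_integrand w k (x n) y) \<le> (\<Prod>j<k. weight_density w (y j))" for n y
    using strip_integrand_bounds[OF w, of k "x n" y] by simp
  then show "AE y in (\<Pi>\<^sub>M j\<in>{..<k}. lborel). norm (strip_integrand w k (x n) y) \<le> (\<Prod>j<k. weight_density w (y j))" for n
    by simp
  \<comment> \<open>Convergence of the determinant is used only on the orthant; elsewhere the
    sequence is constantly zero.\<close>
  have "(\<lambda>n. strip_integrand w k (x n) y) \<longlonglongrightarrow> strip_integrand w k x' y" for y
  proof (cases "y \<in> {..<k} \<rightarrow>\<^sub>E {0<..}")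
    case True
    then have "0 < y j" if "j < k" for j
      using that by (auto simp: PiE_iff)
    with x show ?thesis
      unfolding strip_integrand_def rho_integrand_def by (intro tendsto_intros tendsto_kernel_det_H)
  next
    case False
    then show ?thesis
      by (simp add: strip_integrand_def)
  qed
  then show "AE y in (\<Pi>\<^sub>M j\<in>{..<k}. lborel). (\<lambda>n. strip_integrand w k (x n) y) \<longlonglongrightarrow> strip_integrand w k x' y"
    by simp
qed

text \<open>The countable product \<open>nat \<Rightarrow> real\<close> is metrizable, so sequences
  suffice there, but the claim concerns the product topology on extensional tuples. The map
  \<open>e\<close> links the two spaces continuously and leaves the first \<open>k\<close>
  coordinates, all that \<open>rho\<close> depends on, unchanged.\<close>

lemma continuous_map_rho:
  assumes \<alpha>: "0 < \<alpha>" and w: "w \<in> weights \<alpha> \<beta>"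
  shows "continuous_map (product_topology (\<lambda>_. euclideanreal) {..<k}) euclideanreal (rho w k)"
proof -
  \<comment> \<open>The default 0 replaces \<open>undefined\<close> beyond \<open>k\<close>; as a
    constant it is continuous in \<open>x\<close>.\<close>
  define e where "e x j = (if j < k then x j else 0)" for x :: "nat \<Rightarrow> real" and j
  have "continuous_on UNIV (rho w k)"
    unfolding continuous_on_sequentially
  proof (intro allI ballI impI)
    fix x and x' :: "nat \<Rightarrow> real"
    assume "(\<forall>n. x n \<in> UNIV) \<and> x \<longlonglongrightarrow> x'"
    then have x: "x \<longlonglongrightarrow> x'"
      by simp
    have "continuous_on UNIV (\<lambda>z :: nat \<Rightarrow> real. z j)" for j
      by (rule continuous_on_product_coordinates)
    from continuous_on_tendsto_compose[OF this x] have "(\<lambda>n. x n j) \<longlonglongrightarrow> x' j" for j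
      by simp
    then show "(rho w k \<circ> x) \<longlonglongrightarrow> rho w k x'"
      unfolding comp_def by (intro tendsto_rho[OF \<alpha> w])
  qed
  then have "continuous_map euclidean euclideanreal (rho w k)"
    by simp
  moreover have "continuous_map (product_topology (\<lambda>_. euclideanreal) {..<k}) euclideanreal (\<lambda>x. e x j)" for j
    using continuous_map_product_projection[of j "{..<k}" "\<lambda>_. euclideanreal"]
    by (cases "j < k") (simp_all add: e_def)
  then have "continuous_map (product_topology (\<lambda>_. euclideanreal) {..<k}) euclidean e"
    by (simp only: euclidean_product_topology[symmetric] continuous_map_componentwise_UNIV simp_thms)
  ultimately have "continuous_map (product_topology (\<lambda>_. euclideanreal) {..<k}) euclideanreal (rho w k \<circ> e)"
    by (rule continuous_map_compose[rotated])
  moreover have "rho w k \<circ> e = rho w k"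
    by (auto simp: fun_eq_iff e_def intro!: rho_cong)
  ultimately show ?thesis
    by simp
qed

text \<open>The heights are permuted along with \<open>x\<close>: Lebesgue measure, the product of
  weights and the determinant are each invariant under a simultaneous permutation.\<close>

lemma rho_permute:
  assumes \<alpha>: "0 < \<alpha>" and w: "w \<in> weights \<alpha> \<beta>" and \<sigma>: "\<sigma> permutes {..<k}"
  shows "rho w k (x \<circ> \<sigma>) = rho w k x"
proof -
  let ?R = "\<Pi>\<^sub>M j\<in>{..<k}. lborel :: real measure"
  let ?t = "\<lambda>y. \<lambda>j\<in>{..<k}. y (\<sigma> j)"
  have \<sigma>_in: "\<sigma> j < k \<longleftrightarrow> j < k" for j
    using permutes_in_image[OF \<sigma>, of j] by simp
  have t: "?t \<in> measurable ?R ?R"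
    using \<sigma>_in by (intro measurable_restrict measurable_component_singleton) auto
  have "rho w k (x \<circ> \<sigma>) = (\<integral>y. strip_integrand w k (x \<circ> \<sigma>) y \<partial>distr ?R ?R ?t)"
    unfolding rho_eq by (simp add: distr_PiM_lborel_permute[OF \<sigma>])
  also have "\<dots> = (\<integral>y. strip_integrand w k (x \<circ> \<sigma>) (?t y) \<partial>?R)"
    by (intro integral_distr t borel_measurable_integrable integrable_strip_integrand[OF \<alpha> w])
  also have "\<dots> = (\<integral>y. strip_integrand w k x y \<partial>?R)"
  proof (rule Bochner_Integration.integral_cong)
    fix y assume "y \<in> space ?R"
    then have y: "y \<in> extensional {..<k}"
      by (simp add: space_PiM PiE_iff)
    have "(\<forall>j<k. 0 < y (\<sigma> j)) \<longleftrightarrow> (\<forall>j<k. 0 < y j)"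
      using permutes_inverses(1)[OF \<sigma>] \<sigma>_in by metis
    then have "?t y \<in> {..<k} \<rightarrow>\<^sub>E {0<..} \<longleftrightarrow> y \<in> {..<k} \<rightarrow>\<^sub>E {0<..}"
      using y by (simp add: PiE_iff Ball_def)
    moreover have "rho_integrand w k (x \<circ> \<sigma>) (?t y) = rho_integrand w k x y"
    proof -
      have "rho_integrand w k (x \<circ> \<sigma>) (?t y) = rho_integrand w k (x \<circ> \<sigma>) (y \<circ> \<sigma>)"
        by (rule rho_integrand_cong) simp_all
      also have "\<dots> = (\<Prod>j<k. w (y (\<sigma> j))) * kernel_det kernel_H k ((\<lambda>j. Complex (x j) (y j)) \<circ> \<sigma>)"
        by (simp add: rho_integrand_def comp_def)
      also have "\<dots> = rho_integrand w k x y"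
        unfolding kernel_det_permute[OF \<sigma>]
        using prod.permute[OF \<sigma>, of "\<lambda>j. w (y j)"] by (simp add: rho_integrand_def comp_def)
      finally show ?thesis .
    qed
    ultimately show "strip_integrand w k (x \<circ> \<sigma>) (?t y) = strip_integrand w k x y"
      by (simp add: strip_integrand_def indicator_def)
  qed simp
  finally show ?thesis
    by (simp add: rho_eq)
qed

text \<open>The kernel depends on its arguments only through \<open>z - cnj \<zeta>\<close>, where a
  common real shift cancels.\<close>

lemma rho_translate: "rho w k (\<lambda>j\<in>{..<k}. x j + t) = rho w k x"
proof -
  have "Complex (a + t) c - cnj (Complex (b + t) d) = Complex a c - cnj (Complex b d)" for a b c d
    by (simp add: complex_eq_iff)
  then have "kernel_matrix kernel_H k (\<lambda>j. Complex (x j + t) (y j)) = kernel_matrix kernel_H k (\<lambda>j. Complex (x j) (y j))" for y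
    by (simp add: kernel_matrix_def kernel_H_def)
  then have "strip_integrand w k (\<lambda>j. x j + t) y = strip_integrand w k x y" for y
    by (simp add: strip_integrand_def rho_integrand_def kernel_det_def)
  then have "rho w k (\<lambda>j. x j + t) = rho w k x"
    by (simp add: rho_eq)
  moreover have "rho w k (\<lambda>j\<in>{..<k}. x j + t) = rho w k (\<lambda>j. x j + t)"
    by (rule rho_cong) simp
  ultimately show ?thesis
    by simp
qed

section \<open>The density of the projected moment measure\<close>

lemma upper_half_plane_borel [measurable]: "upper_half_plane \<in> sets borel"
  unfolding upper_half_plane_def by measurable

lemma PiM_area_measure:
  "(\<Pi>\<^sub>M j\<in>{..<k::nat}. area_measure)
    = density (\<Pi>\<^sub>M j\<in>{..<k}. lborel) (\<lambda>z. \<Prod>j<k. indicator upper_half_plane (z j))"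
  unfolding area_measure_def
  \<comment> \<open>An indicator takes only finite values, which is what makes the restricted
    measure sigma-finite.\<close>
  by (intro PiM_density lborel.sigma_finite_measure_axioms)
    (auto simp: indicator_def sigma_finite_measure.sigma_finite_iff_density_finite[OF lborel.sigma_finite_measure_axioms])

text \<open>Nonnegativity of the integrand turns the Bochner integral defining \<open>rho\<close>
  into the nonnegative integral that Tonelli's theorem produces.\<close>

lemma ennreal_rho:
  assumes \<alpha>: "0 < \<alpha>" and w: "w \<in> weights \<alpha> \<beta>"
  shows "ennreal (rho w k x) = (\<integral>\<^sup>+ y. ennreal (strip_integrand w k x y) \<partial>(\<Pi>\<^sub>M j\<in>{..<k}. lborel))"
  unfolding rho_eq
  by (intro nn_integral_eq_integral[symmetric] integrable_strip_integrand[OF \<alpha> w] AE_I2 strip_integrand_bounds(1)[OF w])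

lemma borel_measurable_rho:
  assumes \<alpha>: "0 < \<alpha>" and w: "w \<in> weights \<alpha> \<beta>"
  shows "(\<lambda>x. ennreal (rho w k x)) \<in> borel_measurable (\<Pi>\<^sub>M j\<in>{..<k}. lborel)"
proof -
  interpret R: product_sigma_finite "\<lambda>_. lborel :: real measure" by (rule product_sigma_finite_lborel)
  interpret RI: sigma_finite_measure "\<Pi>\<^sub>M j\<in>{..<k}. lborel :: real measure" by (rule R.sigma_finite) simp
  have "(\<lambda>(x, y). ennreal (strip_integrand w k x y))
      \<in> borel_measurable ((\<Pi>\<^sub>M j\<in>{..<k}. lborel) \<Otimes>\<^sub>M (\<Pi>\<^sub>M j\<in>{..<k}. lborel))"
    using measurable_compose[OF borel_measurable_strip_integrand[OF weightsD(1)[OF w]] measurable_ennreal, of k]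
    by (simp add: case_prod_unfold measurable_cong_sets[OF sets_pair_measure_cong[OF sets_PiM_lborel sets_PiM_lborel] refl])
  then show ?thesis
    unfolding ennreal_rho[OF \<alpha> w] by (intro RI.borel_measurable_nn_integral)
qed

lemma factorial_moment_measure_real_projection:
  fixes k :: nat
  assumes \<alpha>: "0 < \<alpha>" and w: "w \<in> weights \<alpha> \<beta>"
    and Z: "determinantal_process P upper_half_plane area_measure kernel_H Z"
    and thin: "independent_thinning P (\<lambda>z. w (Im z)) Z M"
    and k: "k \<ge> 1"
  shows "factorial_moment_measure P (real_projection M) k
    = density (\<Pi>\<^sub>M j\<in>{..<k}. lborel) (\<lambda>x. ennreal (rho w k x))"
proof (rule measure_eqI)
  show "sets (factorial_moment_measure P (real_projection M) k)
      = sets (density (\<Pi>\<^sub>M j\<in>{..<k}. lborel) (\<lambda>x. ennreal (rho w k x)))"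
    by (simp add: sets_factorial_moment_measure sets_PiM_lborel)
  fix A assume "A \<in> sets (factorial_moment_measure P (real_projection M) k)"
  then have A: "A \<in> sets (\<Pi>\<^sub>M j\<in>{..<k}. borel)"
    by (simp add: sets_factorial_moment_measure)
  have P: "prob_space P" and fmm: "factorial_moment_measure P Z k
      = density (\<Pi>\<^sub>M j\<in>{..<k}. area_measure) (\<lambda>z. ennreal (kernel_det kernel_H k z))"
    using Z k by (auto simp: determinantal_process_def point_process_def)
  note [measurable] = weightsD(1)[OF w] borel_measurable_kernel_det_H
  note w01 = weightsD(2,3)[OF w]
  let ?C = "\<Pi>\<^sub>M j\<in>{..<k}. (borel :: complex measure)"
  let ?R = "\<Pi>\<^sub>M j\<in>{..<k}. (lborel :: real measure)"
  let ?ind = "\<lambda>z. \<Prod>j<k. indicator upper_half_plane (z j) :: ennreal"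
  let ?kd = "\<lambda>z. ennreal (kernel_det kernel_H k z)"
  \<comment> \<open>The retention probabilities together with the event \<open>A\<close> pulled back
    along the projection.\<close>
  define G where "G z = (\<Prod>j<k. ennreal (w (Im (z j)))) * indicator A (\<lambda>j\<in>{..<k}. Re (z j))" for z
  have Re_m: "(\<lambda>z. \<lambda>j\<in>{..<k}. Re (z j)) \<in> measurable ?C (\<Pi>\<^sub>M j\<in>{..<k}. borel)"
    by measurable
  have indA: "(\<lambda>z. indicator A (\<lambda>j\<in>{..<k}. Re (z j)) :: ennreal) \<in> borel_measurable ?C"
    by (rule measurable_compose[OF Re_m borel_measurable_indicator[OF A]])
  then have G [measurable]: "G \<in> borel_measurable ?C"
    unfolding G_def by measurable
  have sets_C: "sets (\<Pi>\<^sub>M j\<in>{..<k}. area_measure) = sets ?C"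
    "sets (\<Pi>\<^sub>M j\<in>{..<k}. (lborel :: complex measure)) = sets ?C"
    by (rule sets_PiM_cong; simp add: area_measure_def)+
  have "emeasure (factorial_moment_measure P (real_projection M) k) A
      = (\<integral>\<^sup>+ z. G z \<partial>factorial_moment_measure P Z k)"
    using nn_integral_thinned_factorial_sum[OF P thin _ _ _ _ A, of Re] w01
    by (simp add: G_def real_projection_def[abs_def])
  also have "\<dots> = (\<integral>\<^sup>+ z. ?kd z * G z \<partial>(\<Pi>\<^sub>M j\<in>{..<k}. area_measure))"
    unfolding fmm by (rule nn_integral_density) (simp_all add: measurable_cong_sets[OF sets_C(1) refl])
  also have "\<dots> = (\<integral>\<^sup>+ z. ?ind z * (?kd z * G z) \<partial>(\<Pi>\<^sub>M j\<in>{..<k}. lborel))"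
    unfolding PiM_area_measure by (rule nn_integral_density) (simp_all add: measurable_cong_sets[OF sets_C(2) refl])
  also have "\<dots> = (\<integral>\<^sup>+ x. \<integral>\<^sup>+ y. ?ind (\<lambda>j\<in>{..<k}. Complex (x j) (y j)) *
      (?kd (\<lambda>j\<in>{..<k}. Complex (x j) (y j)) * G (\<lambda>j\<in>{..<k}. Complex (x j) (y j))) \<partial>?R \<partial>?R)"
    by (rule nn_integral_PiM_lborel_complex) simp_all
  also have "\<dots> = (\<integral>\<^sup>+ x. \<integral>\<^sup>+ y. ennreal (strip_integrand w k x y) * indicator A x \<partial>?R \<partial>?R)"
  proof (intro nn_integral_cong)
    fix x y assume "x \<in> space ?R" "y \<in> space ?R"
    then have ext: "x \<in> extensional {..<k}" "y \<in> extensional {..<k}"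
      by (auto simp: space_PiM PiE_iff)
    let ?z = "\<lambda>j\<in>{..<k}. Complex (x j) (y j)"
    \<comment> \<open>Extensionality of \<open>x\<close> makes the projection return
      \<open>x\<close> itself, not merely a tuple agreeing with it below \<open>k\<close>.\<close>
    have "(\<lambda>j\<in>{..<k}. Re (?z j)) = x"
      using ext(1) by (auto simp: extensional_def fun_eq_iff)
    then have G: "G ?z = ennreal (\<Prod>j<k. w (y j)) * indicator A x"
      by (simp add: G_def prod_ennreal w01)
    have ind: "?ind ?z = indicator ({..<k} \<rightarrow>\<^sub>E {0<..}) y"
      using ext(2) by (auto simp: indicator_def upper_half_plane_def PiE_iff intro!: prod.neutral)
    have kd: "?kd ?z = ennreal (kernel_det kernel_H k (\<lambda>j. Complex (x j) (y j)))"
      by (intro arg_cong[where f = ennreal] kernel_det_cong) simp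
    have W: "0 \<le> (\<Prod>j<k. w (y j))"
      by (intro prod_nonneg) (simp add: w01)
    show "?ind ?z * (?kd ?z * G ?z) = ennreal (strip_integrand w k x y) * indicator A x"
      unfolding G ind kd strip_integrand_def rho_integrand_def
      using W by (simp add: indicator_def ennreal_mult' mult_ac)
  qed
  \<comment> \<open>\<open>A\<close> constrains only real parts, so its indicator is constant in
    \<open>y\<close> and leaves the inner integral.\<close>
  also have "\<dots> = (\<integral>\<^sup>+ x. ennreal (rho w k x) * indicator A x \<partial>?R)"
    unfolding ennreal_rho[OF \<alpha> w]
  proof (intro nn_integral_cong nn_integral_multc)
    show "(\<lambda>y. ennreal (strip_integrand w k x y)) \<in> borel_measurable ?R" for x
      using integrable_strip_integrand[OF \<alpha> w, of k x] by measurable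
  qed
  also have "\<dots> = emeasure (density ?R (\<lambda>x. ennreal (rho w k x))) A"
    using A by (intro emeasure_density[symmetric] borel_measurable_rho[OF \<alpha> w]) (simp add: sets_PiM_lborel)
  finally show "emeasure (factorial_moment_measure P (real_projection M) k) A
      = emeasure (density ?R (\<lambda>x. ennreal (rho w k x))) A" .
qed

theorem proposition2p4:
  fixes \<alpha> \<beta> :: real and w :: "real \<Rightarrow> real"
    and P :: "'w measure" and Z M :: "'w \<Rightarrow> complex measure" and k :: nat
  assumes "0 < \<alpha>" and "\<alpha> < \<beta>" and "w \<in> weights \<alpha> \<beta>"
    and "determinantal_process P upper_half_plane area_measure kernel_H Z"
    and "independent_thinning P (\<lambda>z. w (Im z)) Z M"
    and "k \<ge> 1"
  shows
    "absolutely_continuous (\<Pi>\<^sub>M j\<in>{..<k}. lborel)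
       (factorial_moment_measure P (real_projection M) k) \<and>
     (\<forall>x. set_integrable (\<Pi>\<^sub>M j\<in>{..<k}. lborel) ({..<k} \<rightarrow>\<^sub>E {0<..}) (rho_integrand w k x)) \<and>
     factorial_moment_measure P (real_projection M) k =
       density (\<Pi>\<^sub>M j\<in>{..<k}. lborel) (\<lambda>x. ennreal (rho w k x)) \<and>
     bounded (rho w k ` ({..<k} \<rightarrow>\<^sub>E UNIV)) \<and>
     continuous_map (product_topology (\<lambda>_. euclideanreal) {..<k}) euclideanreal (rho w k) \<and>
     (\<forall>x\<in>{..<k} \<rightarrow>\<^sub>E UNIV. \<forall>\<sigma>. \<sigma> permutes {..<k} \<longrightarrow> rho w k (x \<circ> \<sigma>) = rho w k x) \<and>
     (\<forall>x\<in>{..<k} \<rightarrow>\<^sub>E UNIV. \<forall>t. rho w k (\<lambda>j\<in>{..<k}. x j + t) = rho w k x) \<and>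
     (\<forall>x\<in>{..<k} \<rightarrow>\<^sub>E UNIV. 0 \<le> rho w k x \<and> rho w k x \<le> intensity w ^ k)"
proof (intro conjI ballI allI impI)
  note \<alpha> = \<open>0 < \<alpha>\<close> and w = \<open>w \<in> weights \<alpha> \<beta>\<close>
  note bounds = rho_bounds[OF \<alpha> w]
  show density: "factorial_moment_measure P (real_projection M) k =
       density (\<Pi>\<^sub>M j\<in>{..<k}. lborel) (\<lambda>x. ennreal (rho w k x))"
    by (rule factorial_moment_measure_real_projection[OF \<alpha> w assms(4-6)])
  show "absolutely_continuous (\<Pi>\<^sub>M j\<in>{..<k}. lborel) (factorial_moment_measure P (real_projection M) k)"
    unfolding density by (intro absolutely_continuousI_density borel_measurable_rho[OF \<alpha> w])
  \<comment> \<open>This keeps the formula for \<open>rho\<close> meaningful: the Bochner integral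
    of a non-integrable function would be 0 by convention.\<close>
  show "set_integrable (\<Pi>\<^sub>M j\<in>{..<k}. lborel) ({..<k} \<rightarrow>\<^sub>E {0<..}) (rho_integrand w k x)" for x
    using integrable_strip_integrand[OF \<alpha> w, of k x]
    by (simp add: set_integrable_def strip_integrand_def[abs_def])
  show "bounded (rho w k ` ({..<k} \<rightarrow>\<^sub>E UNIV))"
    unfolding bounded_iff using bounds by (auto intro!: exI[of _ "intensity w ^ k"])
  show "continuous_map (product_topology (\<lambda>_. euclideanreal) {..<k}) euclideanreal (rho w k)"
    by (rule continuous_map_rho[OF \<alpha> w])
  show "rho w k (x \<circ> \<sigma>) = rho w k x" if "\<sigma> permutes {..<k}" for x \<sigma>
    by (rule rho_permute[OF \<alpha> w that])
  show "rho w k (\<lambda>j\<in>{..<k}. x j + t) = rho w k x" for x t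
    by (rule rho_translate)
  show "0 \<le> rho w k x" "rho w k x \<le> intensity w ^ k" for x
    by (rule bounds)+
qed

end
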